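(* For every fixed $\epsilon>0$ there is an algorithm that, given an $m$-tuple $A=(a_1,\ldots,a_m)$ of positive integers, runs in time polynomial in $m$ (with the polynomial's constant factors depending on $\epsilon$) and solves the $(1+\epsilon)$-approximate pinwheel decision problem for $A$: it either correctly declares that $A$ is unschedulable, or correctly declares that $(1+\epsilon)\cdot A=((1+\epsilon)a_1,\ldots,(1+\epsilon)a_m)$ is schedulable. That is, there is a polynomial-time approximation scheme (PTAS) for pinwheel scheduling.
   Context: A pinwheel instance is a tuple $A=(a_1,\ldots,a_m)$ of real numbers $a_i\ge 1$ (periods), with task set $[m]=\{1,\ldots,m\}$. A schedule is a function $\sigma:\mathbb{Z}\to[m]\cup\{\bot\}$ ($\sigma(t)=\bot$ means time $t$ is a holiday). A schedule is valid for $A$ if for every set $I$ of $L$ consecutive integers and every $i\in[m]$, $|\sigma^{-1}(\{i\})\cap I|\ge\lfloor L/a_i\rfloor$. $A$ is schedulable if it has a valid schedule, otherwise unschedulable. For $\alpha>1$, the $\alpha$-approximate decision problem: given an integer tuple $A$, output either "A is unschedulable" (only if true) or "$\alpha\cdot A$ is schedulable" (only if true); when both are true either answer is allowed. *)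

theory Defs
  imports Complex_Main "HOL-Computational_Algebra.Polynomial"
begin

text \<open>
  An instance with \<open>m\<close> tasks is a list of \<open>m\<close> periods. Tasks are numbered \<open>0, \<dots>, m - 1\<close>, as list
  positions are, and \<open>None\<close> marks a holiday.
\<close>

definition is_schedule :: "nat \<Rightarrow> (int \<Rightarrow> nat option) \<Rightarrow> bool" where
  "is_schedule m \<sigma> \<longleftrightarrow> (\<forall>t. \<sigma> t \<in> insert None (Some ` {..<m}))"

definition valid_schedule :: "real list \<Rightarrow> (int \<Rightarrow> nat option) \<Rightarrow> bool" where
  "valid_schedule A \<sigma> \<longleftrightarrow> is_schedule (length A) \<sigma> \<and>
     (\<forall>t. \<forall>L::nat. \<forall>i<length A.
        int (card {u \<in> {t..<t + int L}. \<sigma> u = Some i}) \<ge> \<lfloor>real L / A ! i\<rfloor>)"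

definition schedulable :: "real list \<Rightarrow> bool" where
  "schedulable A \<longleftrightarrow> (\<exists>\<sigma>. valid_schedule A \<sigma>)"

datatype verdict = Unschedulable | Stretched_Schedulable

fun correct_verdict :: "real \<Rightarrow> nat list \<Rightarrow> verdict \<Rightarrow> bool" where
  "correct_verdict \<alpha> A Unschedulable \<longleftrightarrow> \<not> schedulable (map real A)"
| "correct_verdict \<alpha> A Stretched_Schedulable \<longleftrightarrow> schedulable (map (\<lambda>a. \<alpha> * real a) A)"

text \<open>
  Algorithms are programs for the unit-cost RAM of Cook and Reckhow, written with structured
  control instead of jumps. Cells hold integers of any size. The only arithmetic is addition and
  subtraction, so a run of \<open>t\<close> steps lengthens numbers by at most about \<open>t\<close> bits, and the unit
  cost model gives no more power than Turing machines up to a polynomial in time plus input length.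
  Cells are addressed by arbitrary integers, so that indirect access is always defined.
\<close>

type_synonym memory = "int \<Rightarrow> int"

datatype program =
    Skip
  | Set_Const int int
  | Add int int int
  | Sub int int int
  | Load int int
  | Store int int
  | Seq program program
  | If_Pos int program program
  | While_Pos int program

inductive run :: "program \<Rightarrow> memory \<Rightarrow> nat \<Rightarrow> memory \<Rightarrow> bool" where
  Skip: "run Skip s 1 s"
| Set_Const: "run (Set_Const i c) s 1 (s(i := c))"
| Add: "run (Add i j k) s 1 (s(i := s j + s k))"
| Sub: "run (Sub i j k) s 1 (s(i := s j - s k))"
| Load: "run (Load i j) s 1 (s(i := s (s j)))"
| Store: "run (Store i j) s 1 (s(s i := s j))"
| Seq: "run P s t s' \<Longrightarrow> run Q s' u s'' \<Longrightarrow> run (Seq P Q) s (t + u) s''"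
| If_True: "s i > 0 \<Longrightarrow> run P s t s' \<Longrightarrow> run (If_Pos i P Q) s (Suc t) s'"
| If_False: "\<not> s i > 0 \<Longrightarrow> run Q s t s' \<Longrightarrow> run (If_Pos i P Q) s (Suc t) s'"
| While_False: "\<not> s i > 0 \<Longrightarrow> run (While_Pos i P) s 1 s"
| While_True: "s i > 0 \<Longrightarrow> run P s t s' \<Longrightarrow> run (While_Pos i P) s' u s'' \<Longrightarrow>
    run (While_Pos i P) s (Suc (t + u)) s''"

lemma run_deterministic:
  "run P s t s' \<Longrightarrow> run P s u s'' \<Longrightarrow> t = u \<and> s' = s''"
proof (induction arbitrary: u s'' rule: run.induct)
  case (Seq P s t s' Q u s'')
  from Seq.prems show ?case by cases (use Seq.IH in blast)
next
  case (While_True s i P t s' u s'')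
  from While_True.prems show ?case by cases (use While_True.IH While_True.hyps in blast)+
qed (erule run.cases; fastforce)+

text \<open>
  Cell \<open>0\<close> initially holds the number of periods and cells \<open>1, \<dots>, m\<close> hold the periods; all other
  cells, including those with negative addresses, are zero.
\<close>

definition input_memory :: "nat list \<Rightarrow> memory" where
  "input_memory A x =
     (if x = 0 then int (length A)
      else if 1 \<le> x \<and> x \<le> int (length A) then int (A ! (nat x - 1))
      else 0)"

definition output_verdict :: "memory \<Rightarrow> verdict" where
  "output_verdict s = (if s 0 > 0 then Stretched_Schedulable else Unschedulable)"

text \<open>
  The time bound \<open>T\<close> is a function of the number of tasks alone, not of the size of the periods.
  By \<open>run_deterministic\<close>, the existential quantifiers speak about the run on \<open>A\<close>.
\<close>

definition solves_approx_pinwheel_in_time ::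
    "program \<Rightarrow> real \<Rightarrow> (nat \<Rightarrow> nat) \<Rightarrow> bool" where
  "solves_approx_pinwheel_in_time P \<alpha> T \<longleftrightarrow>
     (\<forall>A. (\<forall>a\<in>set A. a > 0) \<longrightarrow>
        (\<exists>t s. run P (input_memory A) t s \<and> t \<le> T (length A) \<and>
               correct_verdict \<alpha> A (output_verdict s)))"

end

theory Submission
  imports Defs "HOL-Library.Disjoint_Sets"
begin

text \<open>
  Let \<open>\<epsilon> \<ge> 1 / k\<close>. Schedulability of the stretched instance is insensitive to the exact long periods:
  there are constants \<open>K\<close> and \<open>\<delta>\<close> such that, if \<open>A\<close> is schedulable, and \<open>A'\<close> has each period up to
  \<open>K\<close> as often as \<open>A\<close> and density at most \<open>\<delta>\<close> larger, then \<open>(1 + 1 / k) A'\<close> is schedulable. So the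
  algorithm only has to find the multiplicities of the periods up to \<open>K\<close> and the density up to an
  error \<open>\<delta>\<close>, and to look up the answer in a finite table; rounding \<open>N (m + 1) / a\<close> down for every
  period \<open>a\<close> makes this possible in quadratic time, whatever the size of the periods.

  For the stability statement, choose a range of periods, out of a sequence of fast growing ranges,
  that has small density in \<open>A\<close>. On the periods below it, a schedule of \<open>A\<close> is a walk in a finite
  graph, and one of its cycles is a periodic schedule with the same holiday density. Inserting one
  new slot after every \<open>k\<close> slots stretches the periods by \<open>1 + 1 / k\<close>. Half of the new slots serve the
  periods in the sparse range; the other half and the holidays serve the long periods. These are
  much longer than the period of the slots, and they are rounded down to the form \<open>x d 2\<^sup>e\<close> with
  \<open>r \<le> x < 2 r\<close>, so that the tasks with the same \<open>x\<close> have harmonic periods and can be packed perfectly.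
\<close>

section \<open>Serving tasks with given slots\<close>

text \<open>The permitted slots and the set of tasks are explicit, so that schedules on disjoint
  slot sets for disjoint task sets can be merged; the floor condition is that of
  \<open>valid_schedule\<close>.\<close>

definition serves :: "int set \<Rightarrow> ('i \<Rightarrow> real) \<Rightarrow> 'i set \<Rightarrow> bool" where
  "serves S b I \<longleftrightarrow> (\<exists>\<sigma>. (\<forall>t i. \<sigma> t = Some i \<longrightarrow> t \<in> S \<and> i \<in> I) \<and>
     (\<forall>i\<in>I. \<forall>t. \<forall>L::nat. \<lfloor>real L / b i\<rfloor> \<le> int (card {u \<in> {t..<t + int L}. \<sigma> u = Some i})))"

lemma serves_empty: "serves S b {}"
  unfolding serves_def by (rule exI[of _ "\<lambda>_. None"]) simp

lemma serves_mono:
  assumes "serves S b I" "S \<subseteq> S'"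
  shows "serves S' b I"
  using assms unfolding serves_def by blast

lemma serves_Un:
  assumes "serves S b I" "serves S' b I'" "S \<inter> S' = {}" "I \<inter> I' = {}"
  shows "serves (S \<union> S') b (I \<union> I')"
proof -
  obtain \<sigma> where s: "\<And>t i. \<sigma> t = Some i \<Longrightarrow> t \<in> S \<and> i \<in> I"
    "\<And>i t L. i \<in> I \<Longrightarrow> \<lfloor>real L / b i\<rfloor> \<le> int (card {u \<in> {t..<t + int L}. \<sigma> u = Some i})"
    using assms(1) unfolding serves_def by blast
  obtain \<sigma>' where s': "\<And>t i. \<sigma>' t = Some i \<Longrightarrow> t \<in> S' \<and> i \<in> I'"
    "\<And>i t L. i \<in> I' \<Longrightarrow> \<lfloor>real L / b i\<rfloor> \<le> int (card {u \<in> {t..<t + int L}. \<sigma>' u = Some i})"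
    using assms(2) unfolding serves_def by blast
  define \<upsilon> where "\<upsilon> = (\<lambda>t. if t \<in> S then \<sigma> t else \<sigma>' t)"
  have 1: "\<upsilon> t = Some i \<longleftrightarrow> \<sigma> t = Some i" if "i \<in> I" for t i
  proof -
    have "i \<notin> I'" using that assms(4) by blast
    then show ?thesis using s(1)[of t i] s'(1)[of t i] unfolding \<upsilon>_def by auto
  qed
  have 2: "\<upsilon> t = Some i \<longleftrightarrow> \<sigma>' t = Some i" if "i \<in> I'" for t i
  proof -
    have "i \<notin> I" "t \<in> S' \<Longrightarrow> t \<notin> S" using that assms(3,4) by blast+
    then show ?thesis using s(1)[of t i] s'(1)[of t i] unfolding \<upsilon>_def by auto
  qed
  show ?thesis
    unfolding serves_def
  proof (intro exI[of _ \<upsilon>] conjI allI ballI impI)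
    fix t i assume "\<upsilon> t = Some i"
    then show "t \<in> S \<union> S'" "i \<in> I \<union> I'"
      using s(1) s'(1) unfolding \<upsilon>_def by (auto split: if_splits)
  next
    fix i t and L :: nat assume "i \<in> I \<union> I'"
    then show "\<lfloor>real L / b i\<rfloor> \<le> int (card {u \<in> {t..<t + int L}. \<upsilon> u = Some i})"
      using s(2) s'(2) 1 2 by (cases "i \<in> I") auto
  qed
qed

lemma serves_UNION:
  assumes "finite X" "\<And>x. x \<in> X \<Longrightarrow> serves (S x) b (I x)"
    and "disjoint_family_on S X" "disjoint_family_on I X"
  shows "serves (\<Union>x\<in>X. S x) b (\<Union>x\<in>X. I x)"
  using assms
proof (induction X)
  case empty
  then show ?case by (simp add: serves_empty)
next
  case (insert x X)
  have "serves (S x \<union> (\<Union>x\<in>X. S x)) b (I x \<union> (\<Union>x\<in>X. I x))"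
  proof (rule serves_Un)
    show "serves (S x) b (I x)" using insert.prems by simp
    show "serves (\<Union>x\<in>X. S x) b (\<Union>x\<in>X. I x)"
      using insert by (auto simp: disjoint_family_on_def)
    show "S x \<inter> (\<Union>x\<in>X. S x) = {}" "I x \<inter> (\<Union>x\<in>X. I x) = {}"
      using insert.prems(2,3) insert.hyps(2) by (auto simp: disjoint_family_on_def)
  qed
  then show ?case by simp
qed

lemma schedulable_iff_serves:
  "schedulable A \<longleftrightarrow> serves UNIV ((!) A) {..<length A}"
proof -
  have "is_schedule m \<sigma> \<longleftrightarrow> (\<forall>t i. \<sigma> t = Some i \<longrightarrow> i < m)" for m \<sigma>
    unfolding is_schedule_def 
  proof safe
    fix t i assume "\<forall>t. \<sigma> t \<in> insert None (Some ` {..<m})" "\<sigma> t = Some i"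
    then have "Some i \<in> insert None (Some ` {..<m})" by metis
    then show "i < m" by auto
  next
    fix t assume *: "\<forall>t i. \<sigma> t = Some i \<longrightarrow> i < m" "\<sigma> t \<notin> Some ` {..<m}"
    then show "\<sigma> t = None" by (cases "\<sigma> t") auto
  qed
  then show ?thesis
    unfolding schedulable_def valid_schedule_def serves_def
    by (intro ex_cong1) (auto simp del: atLeastLessThan_iff)
qed

lemma serves_antimono_period:
  assumes "serves S b I" "\<And>i. i \<in> I \<Longrightarrow> 0 < b i \<and> b i \<le> b' i"
  shows "serves S b' I"
proof -
  have "\<lfloor>real L / b' i\<rfloor> \<le> \<lfloor>real L / b i\<rfloor>" if "i \<in> I" for i L
    using assms(2)[OF that] by (intro floor_mono divide_left_mono) auto
  then show ?thesis
    using assms(1) unfolding serves_def by (meson order_trans)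
qed

lemma div_lt_of_lt_mult:
  fixes t B q :: int
  assumes "B > 0" "t < B * q"
  shows "t div B < q"
proof (rule ccontr)
  assume "\<not> t div B < q"
  then have "B * q \<le> B * (t div B)" using assms(1) by simp
  also have "\<dots> \<le> t" using assms(1) by (simp add: mult.commute minus_mod_eq_mult_div[symmetric])
  finally show False using assms(2) by simp
qed

text \<open>Starting at \<open>x\<close>, each of the consecutive blocks of \<open>B\<close>
  integers contains exactly one member of the class; in block \<open>l\<close> it is
  \<open>x + B * l + (\<rho> - x) mod B\<close>. For \<open>y < x\<close> the left-hand side is
  negative.\<close>

lemma residue_class_card:
  fixes B \<rho> x y :: int
  assumes "B > 0" "0 \<le> \<rho>" "\<rho> < B"
  shows "(y - x) div B \<le> int (card {j \<in> {x..<y}. j mod B = \<rho>})"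
proof (cases "x \<le> y")
  case True
  define q where "q = (y - x) div B"
  have q: "B * q \<le> y - x"
    unfolding q_def using assms(1)
    by (metis div_mod_decomp_int mult.commute le_add_same_cancel1 pos_mod_sign)
  let ?f = "\<lambda>l. x + B * l + (\<rho> - x) mod B"
  have "?f ` {0..<q} \<subseteq> {j \<in> {x..<y}. j mod B = \<rho>}"
  proof
    fix j assume "j \<in> ?f ` {0..<q}"
    then obtain l where l: "0 \<le> l" "l < q" "j = ?f l" by auto
    have "0 \<le> (\<rho> - x) mod B" "(\<rho> - x) mod B < B" using assms(1) by auto
    moreover have "B * l + B \<le> B * q"
      using l assms(1) by (metis add1_zle_eq distrib_left mult.right_neutral mult_left_mono order_less_imp_le)
    moreover have "0 \<le> B * l" using l assms(1) by simp
    ultimately have "x \<le> j" "j < y" using l q by auto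
    moreover have "j mod B = \<rho>"
    proof -
      have "j mod B = (x + (\<rho> - x) mod B) mod B" unfolding l(3)
        using mod_mult_self2[of "x + (\<rho> - x) mod B" B l] by (simp add: algebra_simps)
      also have "\<dots> = (x + (\<rho> - x)) mod B" by (rule mod_add_right_eq)
      finally show ?thesis using assms by simp
    qed
    ultimately show "j \<in> {j \<in> {x..<y}. j mod B = \<rho>}" by simp
  qed
  moreover have "inj_on ?f {0..<q}" using assms(1) by (auto intro: inj_onI)
  ultimately have "card {0..<q} \<le> card {j \<in> {x..<y}. j mod B = \<rho>}"
    by (intro card_inj_on_le) (auto intro: finite_subset[of _ "{x..<y}"])
  then show ?thesis unfolding q_def[symmetric] by auto
next
  case False
  then have "(y - x) div B < 0" using assms(1) by (simp add: div_neg_pos_less0)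
  then show ?thesis by linarith
qed

text \<open>Tasks are inserted by increasing period: the residues already taken modulo the largest
  period number at most \<open>n * 2 ^ e - 1\<close>, so one is left.\<close>
lemma harmonic_residues:
  fixes e :: "'i \<Rightarrow> nat" and n :: nat
  assumes "finite I" "(\<Sum>i\<in>I. 1 / 2 ^ e i) \<le> real n"
  shows "\<exists>\<rho>. (\<forall>i\<in>I. 0 \<le> \<rho> i \<and> \<rho> i < int n * 2 ^ e i) \<and>
    (\<forall>i\<in>I. \<forall>j\<in>I. \<forall>t::int. t mod (int n * 2 ^ e i) = \<rho> i \<longrightarrow> t mod (int n * 2 ^ e j) = \<rho> j \<longrightarrow> i = j)"
  using assms
proof (induction "card I" arbitrary: I)
  case 0
  then show ?case by simp
next
  case (Suc m)
  then have "I \<noteq> {}" by auto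
  then obtain i where i: "i \<in> I" "\<And>j. j \<in> I \<Longrightarrow> e j \<le> e i"
    using obtains_MAX[OF Suc.prems(1), of e] Suc.prems(1) by (metis Max_ge finite_imageI imageI)
  define J where "J = I - {i}"
  have J: "finite J" "I = insert i J" "i \<notin> J" using i Suc.prems unfolding J_def by auto
  have sum: "(\<Sum>i\<in>J. 1 / 2 ^ e i) + 1 / 2 ^ e i \<le> real n"
    using Suc.prems J by simp
  have "(\<Sum>i\<in>J. 1 / 2 ^ e i) \<le> real n"
    using sum by (smt (verit) divide_nonneg_nonneg zero_le_power)
  then obtain \<rho> where \<rho>: "\<forall>i\<in>J. 0 \<le> \<rho> i \<and> \<rho> i < int n * 2 ^ e i"
    "\<forall>i\<in>J. \<forall>j\<in>J. \<forall>t::int. t mod (int n * 2 ^ e i) = \<rho> i \<longrightarrow> t mod (int n * 2 ^ e j) = \<rho> j \<longrightarrow> i = j"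
    using Suc.hyps(1)[of J] Suc.hyps(2) J by auto
  have npos: "n > 0"
  proof (rule ccontr)
    assume "\<not> n > 0"
    then have "(\<Sum>i\<in>J. 1 / 2 ^ e i) + 1 / 2 ^ e i \<le> (0::real)" using sum by simp
    moreover have "(\<Sum>i\<in>J. 1 / 2 ^ e i) \<ge> (0::real)" by (intro sum_nonneg) auto
    moreover have "(0::real) < 1 / 2 ^ e i" by simp
    ultimately show False by linarith
  qed
  define B where "B = int n * 2 ^ e i"
  have Bpos: "B > 0" using npos by (simp add: B_def)
  define O' where "O' j = {t \<in> {0..<B}. t mod (int n * 2 ^ e j) = \<rho> j}" for j
  have cardO: "real (card (O' j)) \<le> 2 ^ e i * (1 / 2 ^ e j)" if "j \<in> J" for j
  proof -
    let ?C = "int n * 2 ^ e j"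
    have C: "?C > 0" using npos by simp
    have le: "e j \<le> e i" using i(2) that J by auto
    have BC: "B = ?C * 2 ^ (e i - e j)"
      unfolding B_def using le by (simp add: power_add[symmetric])
    have "inj_on (\<lambda>t. t div ?C) (O' j)"
      by (rule inj_onI) (metis (mono_tags, lifting) O'_def div_mod_decomp_int mem_Collect_eq)
    moreover have "(\<lambda>t. t div ?C) ` O' j \<subseteq> {0..<2 ^ (e i - e j)}"
    proof (rule image_subsetI)
      fix t assume "t \<in> O' j"
      then have "0 \<le> t" "t < ?C * 2 ^ (e i - e j)" unfolding O'_def BC by auto
      then show "t div ?C \<in> {0..<2 ^ (e i - e j)}"
        using C div_lt_of_lt_mult by (auto simp: pos_imp_zdiv_nonneg_iff)
    qed
    ultimately have "card (O' j) \<le> card {0..<(2::int) ^ (e i - e j)}"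
      by (intro card_inj_on_le) auto
    then have "card (O' j) \<le> 2 ^ (e i - e j)" by (simp add: nat_power_eq)
    then have "real (card (O' j)) \<le> 2 ^ (e i - e j)"
      by (metis of_nat_le_iff of_nat_numeral of_nat_power)
    then show ?thesis using le by (simp add: power_diff)
  qed
  have "real (card (\<Union>j\<in>J. O' j)) \<le> (\<Sum>j\<in>J. real (card (O' j)))"
    using card_UN_le[OF J(1), of O'] by (metis of_nat_le_iff of_nat_sum)
  also have "\<dots> \<le> (\<Sum>j\<in>J. 2 ^ e i * (1 / 2 ^ e j))" by (intro sum_mono cardO)
  also have "\<dots> = 2 ^ e i * (\<Sum>j\<in>J. 1 / 2 ^ e j)" by (simp add: sum_distrib_left)
  also have "\<dots> \<le> 2 ^ e i * (real n - 1 / 2 ^ e i)"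
    using sum by (intro mult_left_mono) auto
  also have "\<dots> < real n * 2 ^ e i" by (simp add: algebra_simps)
  also have "\<dots> = real (card {0..<B})" using npos by (simp add: B_def nat_mult_distrib nat_power_eq)
  finally have "card (\<Union>j\<in>J. O' j) < card {0..<B}" by simp
  then have "\<not> {0..<B} \<subseteq> (\<Union>j\<in>J. O' j)"
  proof -
    have "finite (\<Union>j\<in>J. O' j)"
      using J(1) by (intro finite_UN_I) (auto simp: O'_def intro: finite_subset[of _ "{0..<B}"])
    then show ?thesis using \<open>card (\<Union>j\<in>J. O' j) < card {0..<B}\<close> by (meson card_mono not_le)
  qed
  then obtain t0 where t0: "t0 \<in> {0..<B}" "\<And>j. j \<in> J \<Longrightarrow> t0 mod (int n * 2 ^ e j) \<noteq> \<rho> j"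
    unfolding O'_def by blast
  \<comment> \<open>All moduli divide \<open>B\<close>, so a clash at time \<open>t\<close> would
    already occur at \<open>t mod B = t0\<close>, and \<open>t0\<close> was chosen to avoid
    it.\<close>
  have key: "t mod B \<noteq> t0 \<or> t mod (int n * 2 ^ e j) \<noteq> \<rho> j" if "j \<in> J" for t j
  proof -
    have le: "e j \<le> e i" using i(2) that J by auto
    have "int n * 2 ^ e j dvd B" unfolding B_def by (intro mult_dvd_mono le_imp_power_dvd le) auto
    then have "t mod B mod (int n * 2 ^ e j) = t mod (int n * 2 ^ e j)" by (rule mod_mod_cancel)
    then show ?thesis using t0(2)[OF that] by auto
  qed
  show ?case
  proof (intro exI[of _ "\<rho>(i := t0)"] conjI)
    show "\<forall>j\<in>I. 0 \<le> (\<rho>(i := t0)) j \<and> (\<rho>(i := t0)) j < int n * 2 ^ e j"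
      using \<rho>(1) t0(1) J by (auto simp: B_def)
    show "\<forall>j\<in>I. \<forall>j'\<in>I. \<forall>t. t mod (int n * 2 ^ e j) = (\<rho>(i := t0)) j \<longrightarrow>
        t mod (int n * 2 ^ e j') = (\<rho>(i := t0)) j' \<longrightarrow> j = j'"
      using \<rho>(2) key J unfolding B_def by (auto split: if_splits)
  qed
qed

text \<open>The available slots, \<open>u\<close> in each period of length \<open>P\<close>, are
  numbered by the integers, and each task receives a residue class of slot numbers modulo
  \<open>n * 2 ^ e i\<close>. Such slots are about \<open>n * P * 2 ^ e i / u\<close> apart in time;
  having \<open>c - 2 * P\<close> instead of \<open>c\<close> in the hypothesis pays for the
  incomplete periods at both ends of a window.\<close>

lemma serves_periodic:
  fixes P :: int and u n :: nat and c :: real and e :: "'i \<Rightarrow> nat"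
  assumes P: "P > 0" and S0: "S0 \<subseteq> {0..<P}" "card S0 = u" and I: "finite I"
    and c: "real n * real_of_int P \<le> real u * (c - 2 * real_of_int P)"
    and e: "\<And>i. i \<in> I \<Longrightarrow> c * 2 ^ e i \<le> b i" and sum: "(\<Sum>i\<in>I. 1 / 2 ^ e i) \<le> real n"
  shows "serves {t. t mod P \<in> S0} b I"
proof (cases "I = {}")
  case True
  then show ?thesis by (simp add: serves_empty)
next
  case False
  have finS0: "finite S0" using S0(1) finite_subset by blast
  have "(\<Sum>i\<in>I. 1 / 2 ^ e i) > (0::real)" using False I by (intro sum_pos) auto
  then have npos: "n > 0" using sum by (cases n) auto
  then have "0 < real n * real_of_int P" using P by simp
  then have "0 < real u * (c - 2 * real_of_int P)" using c by linarith
  then have upos: "u > 0" and cP: "c > 2 * real_of_int P" by (auto simp: zero_less_mult_iff)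
  obtain \<rho> where \<rho>: "\<And>i. i \<in> I \<Longrightarrow> 0 \<le> \<rho> i \<and> \<rho> i < int n * 2 ^ e i"
    "\<And>i j t. i \<in> I \<Longrightarrow> j \<in> I \<Longrightarrow> t mod (int n * 2 ^ e i) = \<rho> i \<Longrightarrow>
       t mod (int n * 2 ^ e j) = \<rho> j \<Longrightarrow> i = j"
    using harmonic_residues[OF I sum] by metis
  obtain el where el: "bij_betw el {0..<u} S0"
    using ex_bij_betw_nat_finite[OF finS0] S0(2) by auto
  \<comment> \<open>\<open>ix t\<close> is the number of the slot \<open>t\<close>, and
    \<open>v j\<close> is the slot with number \<open>j\<close>.\<close>
  define ix where "ix t = int u * (t div P) + int (inv_into {0..<u} el (t mod P))" for t
  define v where "v j = P * (j div int u) + el (nat (j mod int u))" for j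
  have el_in: "0 \<le> el k \<and> el k < P \<and> el k \<in> S0" if "k < u" for k
    using el that S0(1) bij_betwE by fastforce
  have modu: "nat (j mod int u) < u" for j :: int using upos by (simp add: nat_less_iff)
  have v_div: "v j div P = j div int u" and v_mod: "v j mod P = el (nat (j mod int u))" for j
    using el_in[OF modu[of j]] P unfolding v_def by auto
  have ix_v: "ix (v j) = j" for j
    using modu[of j] upos bij_betw_imp_inj_on[OF el]
    unfolding ix_def v_div v_mod by (simp add: inv_into_f_f)
  define \<sigma> where "\<sigma> t = (if t mod P \<in> S0 \<and> (\<exists>i\<in>I. ix t mod (int n * 2 ^ e i) = \<rho> i)
     then Some (SOME i. i \<in> I \<and> ix t mod (int n * 2 ^ e i) = \<rho> i) else None)" for t
  have \<sigma>_I: "\<sigma> t = Some i" if "t mod P \<in> S0" "i \<in> I" "ix t mod (int n * 2 ^ e i) = \<rho> i" for t i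
  proof -
    have "(SOME i. i \<in> I \<and> ix t mod (int n * 2 ^ e i) = \<rho> i) = i"
      using that \<rho>(2) by (intro some_equality) auto
    then show ?thesis unfolding \<sigma>_def using that by auto
  qed
  have \<sigma>_D: "t mod P \<in> S0 \<and> i \<in> I" if "\<sigma> t = Some i" for t i
    using that someI_ex[of "\<lambda>i. i \<in> I \<and> ix t mod (int n * 2 ^ e i) = \<rho> i"]
    unfolding \<sigma>_def by (auto split: if_splits)
  show ?thesis
    unfolding serves_def
  proof (intro exI[of _ \<sigma>] conjI allI ballI impI)
    fix t i assume "\<sigma> t = Some i"
    then show "t \<in> {t. t mod P \<in> S0}" "i \<in> I" using \<sigma>_D by auto
  next
    fix i t and L :: nat assume i: "i \<in> I"
    define q where "q = \<lfloor>real L / b i\<rfloor>"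
    show "\<lfloor>real L / b i\<rfloor> \<le> int (card {u \<in> {t..<t + int L}. \<sigma> u = Some i})"
    proof (cases "q \<le> 0")
      case True
      then show ?thesis unfolding q_def by linarith
    next
      case q: False
      define B where "B = int n * 2 ^ e i"
      have B: "B > 0" using npos by (simp add: B_def)
      \<comment> \<open>The periods with index from \<open>x\<close> to \<open>y - 1\<close> are
        those lying entirely in the window; \<open>x\<close> is the ceiling of
        \<open>t / P\<close>.\<close>
      define x where "x = - ((- t) div P)"
      define y where "y = (t + int L) div P"
      have x: "t \<le> P * x" "P * x < t + P"
        unfolding x_def mult_minus_right using pos_mod_bound[OF P, of "-t"] pos_mod_sign[OF P, of "-t"]
          mult_div_mod_eq[of P "-t"] by linarith+
      have y: "P * y \<le> t + int L" "t + int L < P * y + P"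
        unfolding y_def using P pos_mod_bound[OF P, of "t + int L"] pos_mod_sign[OF P, of "t + int L"]
          mult_div_mod_eq[of P "t + int L"] by linarith+
      have "c * 2 ^ e i > 0" using cP P by simp
      then have bpos: "b i > 0" using e[OF i] by linarith
      have "real_of_int q \<le> real L / b i" unfolding q_def by linarith
      then have "real_of_int q * b i \<le> real L" using bpos by (simp add: field_simps)
      then have L: "real_of_int q * (c * 2 ^ e i) \<le> real L"
        using mult_left_mono[OF e[OF i], of "real_of_int q"] q by linarith
      have "int L < P * (y - x) + 2 * P" using x y by (simp add: algebra_simps)
      then have "real L < real_of_int P * real_of_int (y - x) + 2 * real_of_int P"
        by (metis (mono_tags, lifting) of_int_add of_int_less_iff of_int_mult of_int_numeral of_int_of_nat_eq)
      then have 1: "real_of_int q * (c * 2 ^ e i) - 2 * real_of_int P < real_of_int P * real_of_int (y - x)"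
        using L by linarith
      \<comment> \<open>The boundary loss \<open>2 * P\<close> occurs once per window, while the
        hypothesis on \<open>c\<close>, multiplied by \<open>q * 2 ^ e i \<ge> 1\<close>, provides
        \<open>2 * P * q * 2 ^ e i\<close> for it.\<close>
      have 2: "1 \<le> real_of_int q * 2 ^ e i"
        using mult_mono[of 1 "real_of_int q" 1 "2 ^ e i"] q by simp
      have "real_of_int P * (real_of_int q * real_of_int B) = (real_of_int q * 2 ^ e i) * (real n * real_of_int P)"
        unfolding B_def by simp
      also have "\<dots> \<le> (real_of_int q * 2 ^ e i) * (real u * (c - 2 * real_of_int P))"
        using 2 c by (intro mult_left_mono) auto
      also have "\<dots> = real u * (real_of_int q * (c * 2 ^ e i) - 2 * real_of_int P * (real_of_int q * 2 ^ e i))"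
        by (simp add: algebra_simps)
      also have "\<dots> \<le> real u * (real_of_int q * (c * 2 ^ e i) - 2 * real_of_int P * 1)"
        using 2 P by (intro mult_left_mono diff_left_mono) auto
      also have "\<dots> \<le> real u * (real_of_int P * real_of_int (y - x))"
        using 1 by (intro mult_left_mono) auto
      finally have "real_of_int P * (real_of_int q * real_of_int B) \<le> real_of_int P * (real u * real_of_int (y - x))"
        by (simp add: algebra_simps)
      then have "real_of_int q * real_of_int B \<le> real u * real_of_int (y - x)"
        using P by simp
      then have "real_of_int (q * B) \<le> real_of_int (int u * (y - x))" by simp
      then have "q * B \<le> int u * y - int u * x"
        by (simp only: of_int_le_iff right_diff_distrib)
      then have "q \<le> (int u * y - int u * x) div B"
        using B by (metis nonzero_mult_div_cancel_right order_less_irrefl zdiv_mono1)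
      also have "\<dots> \<le> int (card {j \<in> {int u * x..<int u * y}. j mod B = \<rho> i})"
        using \<rho>(1)[OF i] B unfolding B_def by (intro residue_class_card) auto
      also have "\<dots> \<le> int (card {u \<in> {t..<t + int L}. \<sigma> u = Some i})"
      proof -
        have "inj_on v {j \<in> {int u * x..<int u * y}. j mod B = \<rho> i}"
          by (rule inj_on_inverseI[of _ ix]) (rule ix_v)
        moreover have "v ` {j \<in> {int u * x..<int u * y}. j mod B = \<rho> i} \<subseteq>
            {u \<in> {t..<t + int L}. \<sigma> u = Some i}"
        proof (rule image_subsetI)
          fix j assume "j \<in> {j \<in> {int u * x..<int u * y}. j mod B = \<rho> i}"
          then have j: "int u * x \<le> j" "j < int u * y" "j mod B = \<rho> i" by auto
          have "x = (int u * x) div int u" using upos by simp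
          also have "\<dots> \<le> j div int u" using j(1) upos by (intro zdiv_mono1) auto
          finally have jx: "P * x \<le> P * (j div int u)" using P by simp
          have "j div int u < y" using j(2) upos by (intro div_lt_of_lt_mult) auto
          then have "P * (j div int u) + P \<le> P * y"
            using P by (metis add1_zle_eq distrib_left mult.right_neutral mult_left_mono order_less_imp_le)
          then have "v j \<in> {t..<t + int L}"
            using jx x(1) y(1) el_in[OF modu[of j]] unfolding v_def atLeastLessThan_iff by linarith
          moreover have "\<sigma> (v j) = Some i"
            using el_in[OF modu[of j]] i j(3) by (intro \<sigma>_I) (auto simp: v_mod ix_v B_def)
          ultimately show "v j \<in> {u \<in> {t..<t + int L}. \<sigma> u = Some i}" by simp
        qed
        ultimately have "card {j \<in> {int u * x..<int u * y}. j mod B = \<rho> i} \<le>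
            card {u \<in> {t..<t + int L}. \<sigma> u = Some i}"
          by (intro card_inj_on_le) (auto intro: finite_subset[of _ "{t..<t + int L}"])
        then show ?thesis by simp
      qed
      finally show ?thesis unfolding q_def .
    qed
  qed
qed

lemma disjoint_subsets_card:
  assumes "finite X" "finite T" "(\<Sum>x\<in>X. u x) \<le> card T"
  shows "\<exists>F. (\<forall>x\<in>X. F x \<subseteq> T \<and> card (F x) = u x) \<and> disjoint_family_on F X"
  using assms
proof (induction X arbitrary: T)
  case empty
  then show ?case by (auto simp: disjoint_family_on_def)
next
  case (insert x X)
  then have "u x + sum u X \<le> card T" by simp
  then obtain G where G: "G \<subseteq> T" "card G = u x"
    by (meson obtain_subset_with_card_n add_leD1)
  have "card (T - G) = card T - u x"
    using G insert.prems(1) by (simp add: card_Diff_subset finite_subset)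
  then have "sum u X \<le> card (T - G)" using insert by simp
  then obtain F where F: "\<forall>y\<in>X. F y \<subseteq> T - G \<and> card (F y) = u y" "disjoint_family_on F X"
    using insert.IH[of "T - G"] insert.prems(1) by auto
  have "\<forall>y\<in>insert x X. (F(x := G)) y \<subseteq> T \<and> card ((F(x := G)) y) = u y"
    using F(1) G by auto
  moreover have "disjoint_family_on (F(x := G)) (insert x X)"
    using F insert.hyps(2) unfolding disjoint_family_on_def by auto
  ultimately show ?case by blast
qed

text \<open>Take \<open>e\<close> so that \<open>b / (d * 2 ^ e)\<close> lies between
  \<open>r\<close> and \<open>2 * r\<close>, and let \<open>x\<close> be the floor of this quotient.
  Rounding \<open>b\<close> down to \<open>x * d * 2 ^ e\<close> then costs a factor below
  \<open>1 + 1 / r\<close>, with only \<open>r\<close> possible mantissas \<open>x\<close>.\<close>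

lemma dyadic_grid_cell:
  fixes b d :: real and r :: nat
  assumes "d > 0" "r > 0" "b \<ge> real r * d"
  shows "\<exists>e x. r \<le> x \<and> x < 2 * r \<and> real x * d * 2 ^ e \<le> b \<and> b < (real x + 1) * d * 2 ^ e"
proof -
  have rd: "real r * d > 0" using assms by simp
  obtain N where "b / (real r * d) < 2 ^ N"
    using real_arch_pow[of 2 "b / (real r * d)"] by auto
  then have ex: "\<exists>N. b < real r * d * 2 ^ N" using rd by (auto simp: field_simps)
  define N where "N = (LEAST N. b < real r * d * 2 ^ N)"
  have N: "b < real r * d * 2 ^ N" unfolding N_def using ex by (rule LeastI_ex)
  then have "N \<noteq> 0" using assms(3) by (intro notI) simp
  then obtain e where e: "N = Suc e" by (cases N) auto
  have "\<not> b < real r * d * 2 ^ e"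
    using not_less_Least[of e "\<lambda>N. b < real r * d * 2 ^ N"] e N_def by auto
  then have lo: "real r * d * 2 ^ e \<le> b" by simp
  define D where "D = d * 2 ^ e"
  have D: "D > 0" using assms by (simp add: D_def)
  define x where "x = nat \<lfloor>b / D\<rfloor>"
  have bD: "real r \<le> b / D" "b / D < 2 * real r"
    using lo N D unfolding D_def e by (simp_all add: field_simps)
  have x: "real x \<le> b / D" "b / D < real x + 1"
    unfolding x_def using bD(1) by (simp_all add: of_nat_nat)
  have "r \<le> x" unfolding x_def using bD(1) by (metis le_nat_floor)
  moreover have "real x < real (2 * r)" using x(1) bD(2) by simp
  moreover have "real x * d * 2 ^ e \<le> b" "b < (real x + 1) * d * 2 ^ e"
    using x D by (simp_all add: D_def field_simps)
  ultimately show ?thesis by (meson of_nat_less_iff)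
qed

text \<open>Tasks are grouped by the mantissa \<open>x\<close> of their rounded periods, and each
  group gets its own slots. Rounding the periods and the boundary loss of
  \<open>serves_periodic\<close> together cost the factor \<open>(y + 1) / (y - 1)\<close> in the
  group \<open>y\<close>, which is at most \<open>1 + 4 / r\<close>; rounding up the integers
  \<open>n y\<close> and \<open>u y\<close> costs at most two more slots for each of the
  \<open>r\<close> groups.\<close>

lemma serves_long:
  fixes P :: int and r :: nat and s :: real
  assumes P: "P > 0" and S0: "S0 \<subseteq> {0..<P}" and I: "finite I" and r: "r \<ge> 2"
    and b: "\<And>i. i \<in> I \<Longrightarrow> b i \<ge> 2 * real r * real_of_int P"
    and s: "(1 + 4 / real r) * real_of_int P * (\<Sum>i\<in>I. 1 / b i) + 2 * real r \<le> real (card S0)"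
  shows "serves {t. t mod P \<in> S0} b I"
proof -
  define d where "d = 2 * real_of_int P"
  have d: "d > 0" using P by (simp add: d_def)
  have "\<forall>i\<in>I. \<exists>e x. r \<le> x \<and> x < 2 * r \<and> real x * d * 2 ^ e \<le> b i \<and> b i < (real x + 1) * d * 2 ^ e"
    using b d r by (intro ballI dyadic_grid_cell) (auto simp: d_def algebra_simps)
  then obtain e x where ex: "\<And>i. i \<in> I \<Longrightarrow> r \<le> x i \<and> x i < 2 * r \<and>
      real (x i) * d * 2 ^ e i \<le> b i \<and> b i < (real (x i) + 1) * d * 2 ^ e i"
    by metis
  define X where "X = {r..<2 * r}"
  define Ic where "Ic y = {i \<in> I. x i = y}" for y
  define n where "n y = nat \<lceil>\<Sum>i\<in>Ic y. 1 / 2 ^ e i :: real\<rceil>" for y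
  \<comment> \<open>With \<open>c = real y * d\<close> and \<open>d = 2 * P\<close>, the condition
    of \<open>serves_periodic\<close> reads \<open>n y \<le> u y * (2 * y - 2)\<close>.\<close>
  define u where "u y = nat \<lceil>real (n y) / (2 * real y - 2)\<rceil>" for y
  have finIc: "finite (Ic y)" for y using I by (simp add: Ic_def)
  have bpos: "b i > 0" if "i \<in> I" for i
  proof -
    have "2 * real r * real_of_int P > 0" using r P by simp
    then show ?thesis using b[OF that] by linarith
  qed
  have u_le: "real (u y) \<le> (1 + 4 / real r) * real_of_int P * (\<Sum>i\<in>Ic y. 1 / b i) + 2" if "y \<in> X" for y
  proof -
    have y: "r \<le> y" "real y \<ge> 2" using that r by (auto simp: X_def)
    define sy where "sy = (\<Sum>i\<in>Ic y. 1 / b i)"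
    have sy0: "sy \<ge> 0" unfolding sy_def using bpos by (intro sum_nonneg) (auto simp: Ic_def less_imp_le)
    have "(\<Sum>i\<in>Ic y. 1 / 2 ^ e i :: real) \<le> (\<Sum>i\<in>Ic y. (real y + 1) * d * (1 / b i))"
    proof (rule sum_mono)
      fix i assume "i \<in> Ic y"
      then have i: "i \<in> I" "x i = y" by (auto simp: Ic_def)
      have "b i \<le> (real y + 1) * d * 2 ^ e i" using ex[OF i(1)] i(2) by auto
      then show "1 / 2 ^ e i \<le> (real y + 1) * d * (1 / b i)"
        using bpos[OF i(1)] by (simp add: field_simps)
    qed
    also have "\<dots> = (real y + 1) * d * sy" by (simp add: sy_def sum_distrib_left)
    finally have "(\<Sum>i\<in>Ic y. 1 / 2 ^ e i :: real) \<le> (real y + 1) * d * sy" .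
    moreover have "(0::real) \<le> (\<Sum>i\<in>Ic y. 1 / 2 ^ e i)" by (intro sum_nonneg) auto
    ultimately have n: "real (n y) \<le> (real y + 1) * d * sy + 1"
      unfolding n_def by (smt (verit) of_nat_nat ceiling_correct zero_le_ceiling)
    have q: "(real y + 1) / (real y - 1) \<le> 1 + 4 / real r"
    proof -
      have "2 / (real y - 1) \<le> 4 / real r"
        using y r by (simp add: field_simps)
      moreover have "(real y + 1) / (real y - 1) = 1 + 2 / (real y - 1)"
        using y by (simp add: field_simps)
      ultimately show ?thesis by simp
    qed
    have "0 \<le> real (n y) / (2 * real y - 2)" using y by simp
    then have "real (u y) \<le> real (n y) / (2 * real y - 2) + 1"
      unfolding u_def by (smt (verit) of_nat_nat ceiling_correct zero_le_ceiling)
    also have "\<dots> \<le> ((real y + 1) * d * sy + 1) / (2 * real y - 2) + 1"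
      using n y by (intro add_right_mono divide_right_mono) auto
    also have "\<dots> = (real y + 1) / (real y - 1) * real_of_int P * sy + 1 / (2 * real y - 2) + 1"
    proof -
      define z where "z = real y - 1"
      have z: "z > 0" "real y = z + 1" using y by (simp_all add: z_def)
      show ?thesis unfolding z(2) d_def using z(1) by (simp add: field_simps)
    qed
    also have "\<dots> \<le> (1 + 4 / real r) * real_of_int P * sy + 1 + 1"
      using q y P sy0 by (intro add_mono mult_right_mono) (auto simp: field_simps)
    finally show ?thesis by (simp add: sy_def)
  qed
  have "real (\<Sum>y\<in>X. u y) \<le> (\<Sum>y\<in>X. (1 + 4 / real r) * real_of_int P * (\<Sum>i\<in>Ic y. 1 / b i) + 2)"
    unfolding of_nat_sum by (intro sum_mono u_le)
  also have "\<dots> = (1 + 4 / real r) * real_of_int P * (\<Sum>y\<in>X. \<Sum>i\<in>Ic y. 1 / b i) + 2 * real r"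
    by (simp add: sum.distrib sum_distrib_left X_def)
  also have "(\<Sum>y\<in>X. \<Sum>i\<in>Ic y. 1 / b i) = (\<Sum>i\<in>I. 1 / b i)"
    unfolding Ic_def using I ex by (intro sum.group) (auto simp: X_def)
  finally have "real (\<Sum>y\<in>X. u y) \<le> real (card S0)" using s by linarith
  then have "(\<Sum>y\<in>X. u y) \<le> card S0" by (simp only: of_nat_le_iff)
  moreover have "finite X" "finite S0" using finite_subset[OF S0] by (simp_all add: X_def)
  ultimately obtain F where F: "\<And>y. y \<in> X \<Longrightarrow> F y \<subseteq> S0 \<and> card (F y) = u y" "disjoint_family_on F X"
    using disjoint_subsets_card[of X S0 u] by blast
  have "serves (\<Union>y\<in>X. {t. t mod P \<in> F y}) b (\<Union>y\<in>X. Ic y)"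
  proof (rule serves_UNION)
    fix y assume y: "y \<in> X"
    then have y2: "real y \<ge> 2" using r by (auto simp: X_def)
    show "serves {t. t mod P \<in> F y} b (Ic y)"
    proof (rule serves_periodic[OF P _ _ finIc])
      show "F y \<subseteq> {0..<P}" "card (F y) = u y" using F(1)[OF y] S0 by auto
      show "real y * d * 2 ^ e i \<le> b i" if "i \<in> Ic y" for i
        using ex that by (auto simp: Ic_def)
      show "(\<Sum>i\<in>Ic y. 1 / 2 ^ e i) \<le> real (n y)"
        unfolding n_def by (rule real_nat_ceiling_ge)
      have "real (n y) / (2 * real y - 2) \<le> real (u y)"
        unfolding u_def by (rule real_nat_ceiling_ge)
      then have "real (n y) \<le> real (u y) * (2 * real y - 2)"
        using y2 by (simp add: field_simps)
      then have "real (n y) * real_of_int P \<le> real (u y) * (2 * real y - 2) * real_of_int P"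
        using P by (intro mult_right_mono) auto
      then show "real (n y) * real_of_int P \<le> real (u y) * (real y * d - 2 * real_of_int P)"
        by (simp add: d_def algebra_simps)
    qed
  next
    show "disjoint_family_on (\<lambda>y. {t. t mod P \<in> F y}) X"
      using F(2) by (auto simp: disjoint_family_on_def)
  qed (auto simp: X_def Ic_def disjoint_family_on_def)
  moreover have "(\<Union>y\<in>X. Ic y) = I" using ex by (auto simp: X_def Ic_def)
  moreover have "(\<Union>y\<in>X. {t. t mod P \<in> F y}) \<subseteq> {t. t mod P \<in> S0}" using F(1) by auto
  ultimately show ?thesis using serves_mono by metis
qed

section \<open>Periodic schedules of the short tasks\<close>

text \<open>The start is not repeated at the end of the list, so \<open>length c\<close> counts the
  edges, and \<open>distinct c\<close> means a simple cycle.\<close>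

definition closed_walk :: "('a \<Rightarrow> 'a \<Rightarrow> bool) \<Rightarrow> 'a list \<Rightarrow> bool" where
  "closed_walk E c \<longleftrightarrow> c \<noteq> [] \<and> successively E c \<and> E (last c) (hd c)"

lemma walk_split:
  assumes "successively E (xs @ [y] @ ys @ [y] @ zs)"
  shows "closed_walk E (y # ys)" "successively E (xs @ y # zs)"
  using assms
  by (auto simp: closed_walk_def successively_append_iff successively_Cons)

lemma closed_walk_split:
  assumes "closed_walk E (xs @ [y] @ ys @ [y] @ zs)"
  shows "closed_walk E (xs @ y # zs)"
proof -
  have "successively E (xs @ y # zs)"
    using assms walk_split(2)[of E xs y ys zs] unfolding closed_walk_def by simp
  moreover have "last (xs @ y # zs) = last (xs @ [y] @ ys @ [y] @ zs)" by simp
  moreover have "hd (xs @ y # zs) = hd (xs @ [y] @ ys @ [y] @ zs)" by (cases xs) auto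
  ultimately show ?thesis using assms unfolding closed_walk_def by simp
qed

text \<open>At a repeated vertex a closed walk splits into two shorter ones. Their weights add up to
  the old weight, so one of them is still nonnegative.\<close>

lemma distinct_closed_walk_nonneg:
  fixes w :: "'a \<Rightarrow> real"
  assumes "closed_walk E c" "0 \<le> sum_list (map w c)"
  shows "\<exists>c'. closed_walk E c' \<and> distinct c' \<and> set c' \<subseteq> set c \<and> 0 \<le> sum_list (map w c')"
  using assms
proof (induction "length c" arbitrary: c rule: less_induct)
  case less
  show ?case
  proof (cases "distinct c")
    case True
    then show ?thesis using less.prems by blast
  next
    case False
    then obtain xs y ys zs where c: "c = xs @ [y] @ ys @ [y] @ zs"
      using not_distinct_decomp by blast
    let ?c1 = "y # ys" and ?c2 = "xs @ y # zs"
    have cw: "closed_walk E ?c1" "closed_walk E ?c2"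
      using less.prems(1) walk_split(1)[of E xs y ys zs] closed_walk_split[of E xs y ys zs]
      unfolding c by (simp_all add: closed_walk_def)
    have "sum_list (map w c) = sum_list (map w ?c1) + sum_list (map w ?c2)" by (simp add: c)
    then consider "0 \<le> sum_list (map w ?c1)" | "0 \<le> sum_list (map w ?c2)"
      using less.prems(2) by linarith
    then show ?thesis
    proof cases
      case 1
      have "set ?c1 \<subseteq> set c" "length ?c1 < length c" by (auto simp: c)
      then show ?thesis using less.hyps[OF _ cw(1) 1] by blast
    next
      case 2
      have "set ?c2 \<subseteq> set c" "length ?c2 < length c" by (auto simp: c)
      then show ?thesis using less.hyps[OF _ cw(2) 2] by blast
    qed
  qed
qed

text \<open>Cutting out a closed piece of negative weight leaves a shorter, heavier walk. If every
  such piece were negative, this would end in a walk without repetitions, which is too light: it has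
  at most \<open>card S\<close> vertices, each of weight at most \<open>W\<close>.\<close>

lemma heavy_walk_contains_nonneg_cycle:
  fixes w :: "'a \<Rightarrow> real"
  assumes "finite S" "0 \<le> W" "\<And>x. x \<in> S \<Longrightarrow> w x \<le> W"
    and "successively E p" "set p \<subseteq> S" "real (card S) * W < sum_list (map w p)"
  shows "\<exists>c. closed_walk E c \<and> distinct c \<and> set c \<subseteq> S \<and> 0 \<le> sum_list (map w c)"
  using assms(4-6)
proof (induction "length p" arbitrary: p rule: less_induct)
  case less
  show ?case
  proof (cases "distinct p")
    case True
    have "sum_list (map w p) \<le> sum_list (map (\<lambda>_. W) p)"
      using assms(3) less.prems(2) by (intro sum_list_mono) auto
    also have "\<dots> = real (length p) * W" by (simp add: sum_list_triv)
    also have "length p \<le> card S"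
      using True less.prems(2) assms(1) by (metis card_mono distinct_card)
    then have "real (length p) * W \<le> real (card S) * W"
      using assms(2) by (intro mult_right_mono) auto
    finally show ?thesis using less.prems(3) by linarith
  next
    case False
    then obtain xs y ys zs where p: "p = xs @ [y] @ ys @ [y] @ zs"
      using not_distinct_decomp by blast
    let ?c = "y # ys" and ?q = "xs @ y # zs"
    have sw: "closed_walk E ?c" "successively E ?q"
      using walk_split[OF less.prems(1)[unfolded p]] by simp_all
    have sets: "set ?c \<subseteq> S" "set ?q \<subseteq> S" using less.prems(2) by (auto simp: p)
    show ?thesis
    proof (cases "0 \<le> sum_list (map w ?c)")
      case True
      then show ?thesis using distinct_closed_walk_nonneg[OF sw(1)] sets(1) by (meson order_trans)
    next
      case False
      have "sum_list (map w p) = sum_list (map w ?c) + sum_list (map w ?q)" by (simp add: p)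
      then have "real (card S) * W < sum_list (map w ?q)" using less.prems(3) False by linarith
      moreover have "length ?q < length p" by (simp add: p)
      ultimately show ?thesis using less.hyps sw(2) sets(2) by blast
    qed
  qed
qed

lemma card_int_window: "card {j \<in> {0..<L}. Q (int j)} = card {t \<in> {0..<int L}. Q t}"
proof (rule bij_betw_same_card[of int])
  have "{t \<in> {0..<int L}. Q t} = int ` {j \<in> {0..<L}. Q (int j)}"
    by (auto simp: image_iff dest: zero_le_imp_eq_int)
  then show "bij_betw int {j \<in> {0..<L}. Q (int j)} {t \<in> {0..<int L}. Q t}"
    by (simp add: bij_betw_def)
qed

text \<open>The states are the words of length \<open>K\<close> read off the schedule, so that every periodic walk
  on them is again a schedule meeting all deadlines.\<close>
lemma periodic_schedule:
  fixes \<sigma> :: "int \<Rightarrow> 'i option" and a :: "'i \<Rightarrow> nat" and K L :: nat and \<rho> :: real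
  assumes K: "K > 0" and I: "finite I" "\<And>i. i \<in> I \<Longrightarrow> a i \<le> K"
    and \<sigma>: "\<And>t. \<sigma> t \<in> insert None (Some ` I)"
    and win: "\<And>i t. i \<in> I \<Longrightarrow> \<exists>u\<in>{t..<t + int (a i)}. \<sigma> u = Some i"
    and \<rho>: "\<rho> \<ge> -1"
    and hol: "2 * real ((K + 1) ^ K) < real (card {t \<in> {0..<int L}. \<sigma> t = None}) - \<rho> * real L"
  obtains \<tau> p where "0 < p" "p \<le> (K + 1) ^ K" "\<And>t. \<tau> (t + int p) = \<tau> t"
    "\<And>i t. i \<in> I \<Longrightarrow> \<exists>u\<in>{t..<t + int (a i)}. \<tau> u = Some i"
    "\<rho> * real p \<le> real (card {t \<in> {0..<int p}. \<tau> t = None})"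
proof -
  define \<Sigma> where "\<Sigma> = insert None (Some ` I)"
  have fin\<Sigma>: "finite \<Sigma>" using I by (simp add: \<Sigma>_def)
  \<comment> \<open>In one window of \<open>K\<close> slots all tasks of \<open>I\<close> occur, in
    different slots.\<close>
  have cardI: "card I \<le> K"
  proof -
    have "\<forall>i\<in>I. \<exists>u. u \<in> {0..<int K} \<and> \<sigma> u = Some i"
      using win[of _ 0] I(2) by fastforce
    then obtain f where f: "\<And>i. i \<in> I \<Longrightarrow> f i \<in> {0..<int K} \<and> \<sigma> (f i) = Some i" by metis
    then have "inj_on f I" by (metis inj_onI option.inject)
    then have "card I \<le> card {0..<int K}" using f by (intro card_inj_on_le) auto
    then show ?thesis by simp
  qed
  have card\<Sigma>: "card \<Sigma> \<le> K + 1"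
    using card_image_le[OF I(1), of Some] cardI I(1) unfolding \<Sigma>_def
    by (simp add: card_insert_if)
  define S where "S = {x. length x = K \<and> set x \<subseteq> \<Sigma> \<and> (\<forall>i\<in>I. Some i \<in> set (take (a i) x))}"
  have Ssub: "S \<subseteq> {x. set x \<subseteq> \<Sigma> \<and> length x = K}" by (auto simp: S_def)
  have finS: "finite S" using finite_subset[OF Ssub finite_lists_length_eq[OF fin\<Sigma>]] .
  have cardS: "card S \<le> (K + 1) ^ K"
  proof -
    have "card S \<le> card \<Sigma> ^ K"
      using card_mono[OF finite_lists_length_eq[OF fin\<Sigma>] Ssub] card_lists_length_eq[OF fin\<Sigma>] by simp
    also have "\<dots> \<le> (K + 1) ^ K" using card\<Sigma> by (rule power_mono) simp
    finally show ?thesis .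
  qed
  \<comment> \<open>A closed walk has nonnegative weight exactly if its fraction of holidays is at
    least \<open>\<rho>\<close>; \<open>\<rho> \<ge> -1\<close> bounds the weights by
    \<open>2\<close>.\<close>
  define w where "w x = (if hd x = None then 1 else 0) - \<rho>" for x :: "'i option list"
  define E where "E x y \<longleftrightarrow> tl x = butlast y" for x y :: "'i option list"
  define st where "st t = map (\<lambda>d. \<sigma> (t + int d)) [0..<K]" for t
  define p where "p = map (\<lambda>j. st (int j)) [0..<L]"
  have st_S: "st t \<in> S" for t
  proof -
    have "Some i \<in> set (take (a i) (st t))" if i: "i \<in> I" for i
    proof -
      obtain u where u: "u \<in> {t..<t + int (a i)}" "\<sigma> u = Some i" using win[OF i] by blast
      define d where "d = nat (u - t)"
      have d: "d < a i" "d < K" "u = t + int d" using u(1) I(2)[OF i] by (auto simp: d_def)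
      have "take (a i) (st t) ! d = Some i" using d u(2) by (simp add: st_def)
      moreover have "d < length (take (a i) (st t))" using d by (simp add: st_def)
      ultimately show ?thesis by (metis nth_mem)
    qed
    then show ?thesis using \<sigma> by (auto simp: S_def st_def \<Sigma>_def)
  qed
  have st_E: "E (st t) (st (t + 1))" for t
    unfolding E_def st_def by (rule nth_equalityI) (auto simp: nth_tl nth_butlast algebra_simps)
  have st_hd: "hd (st t) = \<sigma> t" for t using K by (simp add: st_def hd_map)
  have "E (st (int j)) (st (int (Suc j)))" for j
    using st_E[of "int j"] by (simp add: add.commute)
  then have "successively E p"
    unfolding p_def successively_conv_nth by (auto simp del: of_nat_Suc)
  moreover have "set p \<subseteq> S" using st_S by (auto simp: p_def)
  moreover have "real (card S) * 2 < sum_list (map w p)"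
  proof -
    have "sum_list (map w p) = (\<Sum>j\<in>{0..<L}. w (st (int j)))"
      by (simp add: p_def comp_def interv_sum_list_conv_sum_set_nat)
    also have "\<dots> = (\<Sum>j\<in>{0..<L}. (if \<sigma> (int j) = None then 1 else 0)) - \<rho> * real L"
      by (simp add: w_def st_hd sum_subtractf)
    also have "(\<Sum>j\<in>{0..<L}. (if \<sigma> (int j) = None then 1 else 0)) =
        real (card {j \<in> {0..<L}. \<sigma> (int j) = None})"
      by (simp add: sum.If_cases Int_def)
    also have "card {j \<in> {0..<L}. \<sigma> (int j) = None} = card {t \<in> {0..<int L}. \<sigma> t = None}"
      by (rule card_int_window)
    finally have "sum_list (map w p) = real (card {t \<in> {0..<int L}. \<sigma> t = None}) - \<rho> * real L" .
    moreover have "real (card S) \<le> real ((K + 1) ^ K)" using cardS by (simp only: of_nat_le_iff)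
    ultimately show ?thesis using hol by linarith
  qed
  moreover have "w x \<le> 2" for x using \<rho> by (simp add: w_def)
  ultimately obtain c where c: "closed_walk E c" "distinct c" "set c \<subseteq> S" "0 \<le> sum_list (map w c)"
    using heavy_walk_contains_nonneg_cycle[OF finS, of 2 w E p] by auto
  define l where "l = length c"
  have l0: "l > 0" using c(1) by (simp add: closed_walk_def l_def)
  define s where "s t = c ! nat (t mod int l)" for t
  have idx: "nat (t mod int l) < l" for t using l0 by (simp add: nat_less_iff)
  have s_S: "s t \<in> S" for t using c(3) idx[of t] unfolding s_def l_def by (metis nth_mem subsetD)
  have s_E: "E (s t) (s (t + 1))" for t
  proof -
    define m where "m = t mod int l"
    have m: "0 \<le> m" "m < int l" using l0 by (simp_all add: m_def)
    have eq: "(t + 1) mod int l = (m + 1) mod int l" unfolding m_def by (simp add: mod_add_left_eq)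
    show ?thesis
    proof (cases "m + 1 < int l")
      case True
      then have "(t + 1) mod int l = m + 1" using eq m by simp
      then have "s (t + 1) = c ! Suc (nat m)" using m by (simp add: s_def nat_add_distrib)
      moreover have "Suc (nat m) < length c" using True m by (simp add: l_def)
      ultimately show ?thesis
        using c(1) unfolding closed_walk_def successively_conv_nth s_def m_def[symmetric] by auto
    next
      case False
      then have m': "m + 1 = int l" using m by simp
      then have "(t + 1) mod int l = 0" using eq by simp
      then have "s (t + 1) = hd c" using l0 by (simp add: s_def hd_conv_nth l_def)
      moreover have "nat m = l - 1" using m' by simp
      then have "s t = last c" using l0 unfolding s_def m_def[symmetric] by (simp add: last_conv_nth l_def)
      ultimately show ?thesis using c(1) by (simp add: closed_walk_def)
    qed
  qed
  define \<tau> where "\<tau> t = hd (s t)" for t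
  \<comment> \<open>Consecutive states overlap in all but one letter, so the word \<open>s t\<close>
    spells the next \<open>K\<close> values of \<open>\<tau>\<close>; the deadlines checked inside
    the words therefore hold for \<open>\<tau>\<close>.\<close>
  have s_nth: "s t ! j = \<tau> (t + int j)" if "j < K" for t j
    using that
  proof (induction j arbitrary: t)
    case 0
    have "length (s t) = K" using s_S by (simp add: S_def)
    then have "s t \<noteq> []" using K by auto
    then show ?case by (simp add: \<tau>_def hd_conv_nth)
  next
    case (Suc j)
    have len: "length (s t) = K" for t using s_S by (simp add: S_def)
    have "s t ! Suc j = tl (s t) ! j" using Suc.prems len by (simp add: nth_tl)
    also have "\<dots> = s (t + 1) ! j" using s_E[of t] Suc.prems len by (simp add: E_def nth_butlast)
    also have "\<dots> = \<tau> (t + 1 + int j)" using Suc by simp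
    finally show ?case by (simp add: algebra_simps)
  qed
  show ?thesis
  proof
    show "0 < l" by (rule l0)
    show "l \<le> (K + 1) ^ K"
      using c(2,3) cardS finS unfolding l_def by (metis card_mono distinct_card order_trans)
    show "\<tau> (t + int l) = \<tau> t" for t by (simp add: \<tau>_def s_def)
    show "\<exists>u\<in>{t..<t + int (a i)}. \<tau> u = Some i" if "i \<in> I" for i t
    proof -
      have "Some i \<in> set (take (a i) (s t))" using s_S[of t] that by (auto simp: S_def)
      then obtain j where "j < length (take (a i) (s t))" "take (a i) (s t) ! j = Some i"
        by (metis in_set_conv_nth)
      then have "j < a i" "\<tau> (t + int j) = Some i" using s_nth[of j t] s_S[of t] by (auto simp: S_def)
      then show ?thesis by (intro bexI[of _ "t + int j"]) auto
    qed
    have "sum_list (map w c) = (\<Sum>j\<in>{0..<l}. w (c ! j))"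
      by (simp add: l_def sum_list_sum_nth)
    also have "\<dots> = (\<Sum>j\<in>{0..<l}. (if \<tau> (int j) = None then 1 else 0) - \<rho>)"
      by (intro sum.cong) (auto simp: w_def \<tau>_def s_def)
    also have "\<dots> = (\<Sum>j\<in>{0..<l}. (if \<tau> (int j) = None then 1 else 0)) - \<rho> * real l"
      by (simp add: sum_subtractf)
    also have "(\<Sum>j\<in>{0..<l}. (if \<tau> (int j) = None then 1 else 0)) =
        real (card {j \<in> {0..<l}. \<tau> (int j) = None})"
      by (simp add: sum.If_cases Int_def)
    also have "card {j \<in> {0..<l}. \<tau> (int j) = None} = card {t \<in> {0..<int l}. \<tau> t = None}"
      by (rule card_int_window)
    finally show "\<rho> * real l \<le> real (card {t \<in> {0..<int l}. \<tau> t = None})"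
      using c(4) by linarith
  qed
qed

section \<open>Stretching and the stability of schedulability\<close>

text \<open>Every \<open>(k + 1)\<close>-st time slot is new, and \<open>old_time k t\<close> counts the others before \<open>t\<close>.\<close>
definition old_time :: "int \<Rightarrow> int \<Rightarrow> int" where
  "old_time k t = k * (t div (k + 1)) + t mod (k + 1)"

text \<open>The opposite direction: the slot to which the old slot number \<open>j\<close> is moved.
  For \<open>k \<ge> 1\<close> its residue modulo \<open>k + 1\<close> is never \<open>k\<close>,
  the residue of the new slots.\<close>

definition new_time :: "int \<Rightarrow> int \<Rightarrow> int" where
  "new_time k j = (k + 1) * (j div k) + j mod k"

text \<open>Without the division, comparisons of old times become linear inequalities with an error
  term between \<open>0\<close> and \<open>k\<close>.\<close>

lemma old_time_mult:
  assumes "k \<ge> 1"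
  shows "(k + 1) * old_time k t = k * t + t mod (k + 1)"
proof -
  have "t = (k + 1) * (t div (k + 1)) + t mod (k + 1)" by simp
  then have "k * t = k * ((k + 1) * (t div (k + 1)) + t mod (k + 1))" by presburger
  then show ?thesis unfolding old_time_def by (simp add: algebra_simps)
qed

lemma new_time_mod: "k \<ge> 1 \<Longrightarrow> new_time k j mod (k + 1) = j mod k"
  unfolding new_time_def by (simp add: mod_add_left_eq) (smt (verit) mod_pos_pos_trivial pos_mod_bound pos_mod_sign)

lemma old_time_new_time:
  assumes "k \<ge> 1"
  shows "old_time k (new_time k j) = j"
proof -
  have "0 \<le> j mod k" "j mod k < k" using assms by auto
  then have "j mod k div (k + 1) = 0" by (intro div_pos_pos_trivial) auto
  then have "new_time k j div (k + 1) = j div k" using assms by (simp add: new_time_def)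
  then show ?thesis using new_time_mod[OF assms] by (simp add: old_time_def)
qed

lemma old_time_shift:
  assumes "k \<ge> 1"
  shows "old_time k (t + (k + 1) * m) = old_time k t + k * m"
proof -
  have "(t + (k + 1) * m) div (k + 1) = m + t div (k + 1)" using assms by simp
  moreover have "(t + (k + 1) * m) mod (k + 1) = t mod (k + 1)" by (rule mod_mult_self2)
  ultimately show ?thesis by (simp only: old_time_def distrib_left)
qed

text \<open>Multiplied by \<open>k + 1\<close>, old time is \<open>k * t\<close> up to the error
  term of \<open>old_time_mult\<close>. On an old slot this error is below \<open>k\<close>, and the
  strictness decides the comparison at the left end of the window.\<close>

lemma new_time_bounds:
  assumes k: "k \<ge> 1" and j: "old_time k t \<le> j" "j < old_time k t'"
  shows "t \<le> new_time k j" "new_time k j < t'"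
proof -
  define x where "x = new_time k j"
  have o: "old_time k x = j" using old_time_new_time[OF k] by (simp add: x_def)
  have xm: "0 \<le> x mod (k + 1)" "x mod (k + 1) < k" using new_time_mod[OF k, of j] k by (simp_all add: x_def)
  have m: "0 \<le> s mod (k + 1)" "s mod (k + 1) \<le> k" for s
    using k pos_mod_bound[of "k + 1" s] by auto
  show "t \<le> new_time k j"
  proof (rule ccontr)
    assume "\<not> ?thesis"
    then have "k * (x + 1) \<le> k * t" using k by (simp add: x_def)
    then have "(k + 1) * old_time k x < (k + 1) * old_time k t"
      unfolding old_time_mult[OF k] distrib_left mult_1_right using xm m(1)[of t] by linarith
    then show False using j(1) o k by simp
  qed
  show "new_time k j < t'"
  proof (rule ccontr)
    assume "\<not> ?thesis"
    then have "k * t' \<le> k * x" using k by (simp add: x_def)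
    then have "(k + 1) * old_time k t' < (k + 1) * old_time k x + (k + 1)"
      unfolding old_time_mult[OF k] using xm m(2)[of t'] by linarith
    then have "(k + 1) * old_time k t' < (k + 1) * (old_time k x + 1)" by (simp add: algebra_simps)
    then have "old_time k t' < old_time k x + 1" using k by (simp only: mult_less_cancel_left_pos)
    then show False using j(2) o by simp
  qed
qed

lemma window_count:
  fixes a q :: nat
  assumes "\<And>t. \<exists>u\<in>{t..<t + int a}. \<tau> u = Some i"
  shows "q \<le> card {u \<in> {t..<t + int (q * a)}. \<tau> u = Some i}"
proof (induction q)
  case (Suc q)
  obtain u where u: "u \<in> {t + int (q * a)..<t + int (q * a) + int a}" "\<tau> u = Some i"
    using assms by blast
  have "Suc q \<le> card (insert u {u \<in> {t..<t + int (q * a)}. \<tau> u = Some i})"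
    using Suc u by (subst card_insert_disjoint) (auto intro: finite_subset[of _ "{t..<t + int (q * a)}"])
  also have "\<dots> \<le> card {u \<in> {t..<t + int (Suc q * a)}. \<tau> u = Some i}"
    using u order_trans[of t "t + int (q * a)" u] by (intro card_mono) (auto intro: finite_subset[of _ "{t..<t + int (Suc q * a)}"])
  finally show ?case .
qed simp

text \<open>A window of \<open>L\<close> slots contains at least \<open>\<lfloor>k L / (k + 1)\<rfloor>\<close> old ones, so that the periods of a
  schedule on the old slots are multiplied by \<open>1 + 1 / k\<close>.\<close>
lemma serves_stretched:
  fixes k :: nat and a :: "'j \<Rightarrow> nat" and \<pi> :: "'j \<Rightarrow> 'i"
  assumes k: "k \<ge> 1" and inj: "inj_on \<pi> J" and apos: "\<And>j. j \<in> J \<Longrightarrow> a j > 0"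
    and win: "\<And>j t. j \<in> J \<Longrightarrow> \<exists>u\<in>{t..<t + int (a j)}. \<tau> u = Some (\<pi> j)"
  shows "serves {t. t mod (int k + 1) \<noteq> int k \<and> \<tau> (old_time (int k) t) \<noteq> None}
    (\<lambda>j. (1 + 1 / real k) * real (a j)) J"
proof -
  let ?k = "int k"
  have k1: "?k \<ge> 1" using k by simp
  define \<sigma> where "\<sigma> t = (if t mod (?k + 1) \<noteq> ?k then
     (case \<tau> (old_time ?k t) of None \<Rightarrow> None
      | Some i \<Rightarrow> if i \<in> \<pi> ` J then Some (inv_into J \<pi> i) else None) else None)" for t
  have \<sigma>_Some: "\<sigma> t = Some j" if "j \<in> J" "t mod (?k + 1) \<noteq> ?k" "\<tau> (old_time ?k t) = Some (\<pi> j)" for t j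
    using that inj by (simp add: \<sigma>_def)
  show ?thesis
    unfolding serves_def
  proof (intro exI[of _ \<sigma>] conjI allI ballI impI)
    fix t j assume *: "\<sigma> t = Some j"
    then show "t \<in> {t. t mod (?k + 1) \<noteq> ?k \<and> \<tau> (old_time ?k t) \<noteq> None}" "j \<in> J"
      by (auto simp: \<sigma>_def inv_into_into split: if_splits option.splits)
  next
    fix j t and L :: nat assume j: "j \<in> J"
    define q where "q = nat \<lfloor>real L / ((1 + 1 / real k) * real (a j))\<rfloor>"
    have ka: "real k > 0" "real (a j) > 0" using k apos[OF j] by auto
    have "real q \<le> real L / ((1 + 1 / real k) * real (a j))"
      unfolding q_def using ka by (simp add: of_nat_nat)
    also have "\<dots> = real L * real k / ((real k + 1) * real (a j))"
      using ka by (simp add: field_simps)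
    finally have "real q * ((real k + 1) * real (a j)) \<le> real L * real k"
      using ka by (simp add: pos_le_divide_eq)
    then have "real ((k + 1) * (q * a j)) \<le> real (k * L)"
      by (simp add: algebra_simps)
    then have "(k + 1) * (q * a j) \<le> k * L" by (simp only: of_nat_le_iff)
    then have "int ((k + 1) * (q * a j)) \<le> int (k * L)" by (simp only: of_nat_le_iff)
    then have 1: "(?k + 1) * int (q * a j) \<le> ?k * int L" by (simp add: algebra_simps)
    define T where "T = t + int L"
    \<comment> \<open>The remainders at the two ends differ by at most \<open>k\<close>, so
      \<open>k + 1\<close> times the number of old slots in the window is at least
      \<open>k * L - k\<close>; the missing \<open>k\<close> disappears by integrality.\<close>
    have "(?k + 1) * old_time ?k T + ?k \<ge> ?k * int L + (?k + 1) * old_time ?k t"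
      unfolding old_time_mult[OF k1] T_def distrib_left[of ?k t] using k1
        pos_mod_sign[of "?k + 1" "t + int L"] pos_mod_bound[of "?k + 1" t] by linarith
    then have "(?k + 1) * (old_time ?k t + int (q * a j)) < (?k + 1) * (old_time ?k T + 1)"
      using 1 by (simp add: algebra_simps)
    then have 2: "old_time ?k t + int (q * a j) \<le> old_time ?k T"
      using k1 by (simp add: mult_less_cancel_left_pos)
    have "q \<le> card {u \<in> {old_time ?k t..<old_time ?k t + int (q * a j)}. \<tau> u = Some (\<pi> j)}"
      by (rule window_count[OF win[OF j]])
    also have "\<dots> \<le> card {u \<in> {t..<T}. \<sigma> u = Some j}"
    proof (rule card_inj_on_le)
      show "inj_on (new_time ?k) {u \<in> {old_time ?k t..<old_time ?k t + int (q * a j)}. \<tau> u = Some (\<pi> j)}"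
        by (rule inj_on_inverseI[of _ "old_time ?k"]) (rule old_time_new_time[OF k1])
      show "new_time ?k ` {u \<in> {old_time ?k t..<old_time ?k t + int (q * a j)}. \<tau> u = Some (\<pi> j)}
          \<subseteq> {u \<in> {t..<T}. \<sigma> u = Some j}"
      proof (rule image_subsetI)
        fix u assume "u \<in> {u \<in> {old_time ?k t..<old_time ?k t + int (q * a j)}. \<tau> u = Some (\<pi> j)}"
        then have u: "old_time ?k t \<le> u" "u < old_time ?k T" "\<tau> u = Some (\<pi> j)" using 2 by auto
        have "new_time ?k u mod (?k + 1) \<noteq> ?k"
          using new_time_mod[OF k1, of u] k1 pos_mod_bound[of ?k u] by linarith
        then have "\<sigma> (new_time ?k u) = Some j"
          using j u(3) by (intro \<sigma>_Some) (auto simp: old_time_new_time[OF k1])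
        then show "new_time ?k u \<in> {u \<in> {t..<T}. \<sigma> u = Some j}"
          using new_time_bounds[OF k1 u(1,2)] by simp
      qed
    qed (auto intro: finite_subset[of _ "{t..<T}"])
    finally show "\<lfloor>real L / ((1 + 1 / real k) * real (a j))\<rfloor> \<le>
        int (card {u \<in> {t..<t + int L}. \<sigma> u = Some j})"
      unfolding q_def T_def by linarith
  qed
qed

lemma periodic_shift:
  fixes \<tau> :: "int \<Rightarrow> 'a" and p :: nat
  assumes "\<And>t. \<tau> (t + int p) = \<tau> t"
  shows "\<tau> (t + int p * m) = \<tau> t"
proof -
  have nat: "\<tau> (t + int p * int n) = \<tau> t" for n t
  proof (induction n)
    case (Suc n)
    have "\<tau> (t + int p * int (Suc n)) = \<tau> (t + int p * int n + int p)" by (simp add: algebra_simps)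
    then show ?case using assms Suc by simp
  qed simp
  show ?thesis
  proof (cases "m \<ge> 0")
    case True
    then show ?thesis using nat[of t "nat m"] by simp
  next
    case False
    then show ?thesis using nat[of "t + int p * m" "nat (- m)"] by simp
  qed
qed

lemma periodic_count:
  fixes \<tau> :: "int \<Rightarrow> 'a" and p :: nat
  assumes "\<And>t. \<tau> (t + int p) = \<tau> t"
  shows "card {t \<in> {0..<int (n * p)}. \<tau> t = z} = n * card {t \<in> {0..<int p}. \<tau> t = z}"
proof (induction n)
  case (Suc n)
  let ?f = "\<lambda>t. t + int p * int n"
  have "{t \<in> {0..<int (Suc n * p)}. \<tau> t = z} =
      {t \<in> {0..<int (n * p)}. \<tau> t = z} \<union> ?f ` {t \<in> {0..<int p}. \<tau> t = z}"
  proof (intro set_eqI iffI)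
    fix t assume t: "t \<in> {t \<in> {0..<int (Suc n * p)}. \<tau> t = z}"
    show "t \<in> {t \<in> {0..<int (n * p)}. \<tau> t = z} \<union> ?f ` {t \<in> {0..<int p}. \<tau> t = z}"
    proof (cases "t < int (n * p)")
      case False
      have "\<tau> (t - int p * int n) = z"
        using periodic_shift[of \<tau>, OF assms, of t "- int n"] t by simp
      then have "t - int p * int n \<in> {t \<in> {0..<int p}. \<tau> t = z}"
        using t False by (auto simp: algebra_simps)
      then show ?thesis by (intro UnI2 image_eqI[of _ _ "t - int p * int n"]) auto
    qed (use t in auto)
  next
    fix t assume "t \<in> {t \<in> {0..<int (n * p)}. \<tau> t = z} \<union> ?f ` {t \<in> {0..<int p}. \<tau> t = z}"
    then show "t \<in> {t \<in> {0..<int (Suc n * p)}. \<tau> t = z}"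
      using periodic_shift[of \<tau>, OF assms] by (auto simp: algebra_simps)
  qed
  moreover have "card (?f ` {t \<in> {0..<int p}. \<tau> t = z}) = card {t \<in> {0..<int p}. \<tau> t = z}"
    by (intro card_image inj_onI) auto
  moreover have "finite {t \<in> {0..<int p}. \<tau> t = z}" "finite {t \<in> {0..<int (n * p)}. \<tau> t = z}"
    by (auto intro: finite_subset[of _ "{0..<int p}"] finite_subset[of _ "{0..<int (n * p)}"])
  moreover have "{t \<in> {0..<int (n * p)}. \<tau> t = z} \<inter> ?f ` {t \<in> {0..<int p}. \<tau> t = z} = {}"
    by (auto simp: algebra_simps)
  ultimately show ?case using Suc by (simp add: card_Un_disjoint)
qed simp

text \<open>Half of the new slots serve the tasks of medium period, the other half joins the holidays of
  the periodic schedule \<open>\<tau>\<close> and serves those of long period.\<close>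
lemma serves_in_free_slots:
  fixes k p :: nat and \<tau> :: "int \<Rightarrow> 'i option" and b :: "'j \<Rightarrow> real"
  assumes k: "k \<ge> 1" and p: "p > 0" and \<tau>: "\<And>t. \<tau> (t + int p) = \<tau> t"
    and J: "finite J" "\<And>j. j \<in> J \<Longrightarrow> b j \<ge> real (2 * r * (2 * (k + 1) * p * (8 * r)))"
    and r: "r = 64 * (k + 1)"
    and sum: "(\<Sum>j\<in>J. 1 / b j) \<le> 2"
    and dens: "(\<Sum>j\<in>J. 1 / b j) * (2 * (real k + 1)) * real p + real p / 2 \<le>
      2 * real k * real (card {t \<in> {0..<int p}. \<tau> t = None}) + real p"
  shows "serves ({t. t mod (int k + 1) \<noteq> int k \<and> \<tau> (old_time (int k) t) = None} \<union>
      {t. t mod (2 * (int k + 1)) = 2 * int k + 1}) b J"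
proof -
  let ?k = "int k"
  have k1: "?k \<ge> 1" using k by simp
  define g where "g = 8 * r"
  \<comment> \<open>A period of length \<open>P\<close> contains \<open>2 * k * g\<close> periods of
    \<open>\<tau>\<close> on its old slots, and \<open>p * g\<close> of its \<open>2 * p * g\<close>
    new slots lie in \<open>N\<close>.\<close>
  define P where "P = 2 * (?k + 1) * int p * int g"
  have P: "P > 0" using p r by (simp add: P_def g_def)
  define H where "H = {t. t mod (?k + 1) \<noteq> ?k \<and> \<tau> (old_time ?k t) = None}"
  define N where "N = {t. t mod (2 * (?k + 1)) = 2 * ?k + 1}"
  define S0 where "S0 = (H \<union> N) \<inter> {0..<P}"
  have per: "{t. t mod P \<in> S0} \<subseteq> H \<union> N"
  proof
    fix t assume "t \<in> {t. t mod P \<in> S0}"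
    then have t: "t mod P \<in> H \<union> N" by (simp add: S0_def)
    define m where "m = t div P"
    have te: "t = t mod P + P * m" by (simp add: m_def)
    have "t mod P mod (2 * (?k + 1)) = t mod (2 * (?k + 1))" "t mod P mod (?k + 1) = t mod (?k + 1)"
    proof (rule_tac [!] mod_mod_cancel)
      show "2 * (?k + 1) dvd P" by (simp add: P_def)
      then show "?k + 1 dvd P" using dvd_mult_right by blast
    qed
    moreover have "\<tau> (old_time ?k t) = \<tau> (old_time ?k (t mod P))"
    proof -
      have "old_time ?k t = old_time ?k (t mod P + (?k + 1) * (2 * int p * int g * m))"
        by (subst te) (simp add: P_def algebra_simps)
      also have "\<dots> = old_time ?k (t mod P) + int p * (?k * (2 * int g * m))"
        unfolding old_time_shift[OF k1] by (simp add: algebra_simps)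
      finally show ?thesis using periodic_shift[of \<tau>, OF \<tau>] by simp
    qed
    ultimately show "t \<in> H \<union> N" using t by (auto simp: H_def N_def)
  qed
  define h where "h = card {t \<in> {0..<int p}. \<tau> t = None}"
  have HN: "H \<inter> N = {}"
  proof -
    have "t mod (?k + 1) = ?k" if "t \<in> N" for t
    proof -
      have "t mod (2 * (?k + 1)) mod (?k + 1) = t mod (?k + 1)" by (rule mod_mod_cancel) (rule dvd_triv_right)
      moreover have "(2 * ?k + 1) mod (?k + 1) = ?k"
      proof -
        have "2 * ?k + 1 = ?k + (?k + 1) * 1" by simp
        then show ?thesis by (simp only: mod_mult_self2) simp
      qed
      ultimately show ?thesis using that unfolding N_def by simp
    qed
    then show ?thesis by (auto simp: H_def)
  qed
  have cH: "2 * k * g * h \<le> card (H \<inter> {0..<P})"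
  proof -
    have "2 * k * g * h = card {t \<in> {0..<int (2 * k * g * p)}. \<tau> t = None}"
      unfolding h_def by (rule periodic_count[of \<tau>, OF \<tau>, symmetric])
    also have "\<dots> \<le> card (H \<inter> {0..<P})"
    proof (rule card_inj_on_le)
      show "inj_on (new_time ?k) {t \<in> {0..<int (2 * k * g * p)}. \<tau> t = None}"
        by (rule inj_on_inverseI[of _ "old_time ?k"]) (rule old_time_new_time[OF k1])
      show "new_time ?k ` {t \<in> {0..<int (2 * k * g * p)}. \<tau> t = None} \<subseteq> H \<inter> {0..<P}"
      proof (rule image_subsetI)
        fix u assume "u \<in> {t \<in> {0..<int (2 * k * g * p)}. \<tau> t = None}"
        then have u: "0 \<le> u" "u < int (2 * k * g * p)" "\<tau> u = None" by auto
        have o0: "old_time ?k 0 = 0" by (simp add: old_time_def)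
        have "old_time ?k P = int (2 * k * g * p)"
          using old_time_shift[OF k1, of 0 "2 * int p * int g"] o0 by (simp add: P_def algebra_simps)
        then have "0 \<le> new_time ?k u" "new_time ?k u < P"
          using new_time_bounds[OF k1, of 0 u P] u o0 by auto
        moreover have "new_time ?k u mod (?k + 1) \<noteq> ?k"
          using new_time_mod[OF k1, of u] k1 pos_mod_bound[of ?k u] by linarith
        ultimately show "new_time ?k u \<in> H \<inter> {0..<P}"
          using u(3) by (simp add: H_def old_time_new_time[OF k1])
      qed
    qed (auto intro: finite_subset[of _ "{0..<P}"])
    finally show ?thesis .
  qed
  have cN: "p * g \<le> card (N \<inter> {0..<P})"
  proof -
    let ?f = "\<lambda>l. 2 * (?k + 1) * l + (2 * ?k + 1)"
    have "card {0..<int (p * g)} \<le> card (N \<inter> {0..<P})"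
    proof (rule card_inj_on_le)
      show "inj_on ?f {0..<int (p * g)}" using k1 by (intro inj_onI) simp
      show "?f ` {0..<int (p * g)} \<subseteq> N \<inter> {0..<P}"
      proof (rule image_subsetI)
        fix l assume l: "l \<in> {0..<int (p * g)}"
        have "2 * (?k + 1) * (l + 1) \<le> 2 * (?k + 1) * int (p * g)"
          using l k1 by (intro mult_left_mono) auto
        then have "?f l < P" using k1 by (simp add: P_def algebra_simps)
        moreover have "0 \<le> ?f l" using l k1 by simp
        moreover have "?f l mod (2 * (?k + 1)) = 2 * ?k + 1"
          using k1 by (simp add: mod_pos_pos_trivial)
        ultimately show "?f l \<in> N \<inter> {0..<P}" by (simp add: N_def)
      qed
    qed (auto intro: finite_subset[of _ "{0..<P}"])
    then show ?thesis by (simp add: nat_mult_distrib)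
  qed
  have "card S0 = card (H \<inter> {0..<P}) + card (N \<inter> {0..<P})"
    unfolding S0_def Int_Un_distrib2
    using HN by (intro card_Un_disjoint) (auto intro: finite_subset[of _ "{0..<P}"])
  then have cS: "2 * k * g * h + p * g \<le> card S0" using cH cN by linarith
  define s where "s = (\<Sum>j\<in>J. 1 / b j)"
  have rP: "real_of_int P = 2 * (real k + 1) * real p * real g" by (simp add: P_def)
  have "serves {t. t mod P \<in> S0} b J"
  proof (rule serves_long[OF P _ J(1), where r = r])
    show "S0 \<subseteq> {0..<P}" "r \<ge> 2" by (auto simp: S0_def r)
    show "2 * real r * real_of_int P \<le> b j" if "j \<in> J" for j
      using J(2)[OF that] unfolding rP g_def by (simp add: algebra_simps)
    \<comment> \<open>The slack \<open>p / 2\<close> in \<open>dens\<close>, times \<open>g\<close>,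
      pays for both losses of \<open>serves_long\<close>: \<open>r = 64 * (k + 1)\<close> keeps the
      loss from the factor \<open>1 + 4 / r\<close> below \<open>p * g / 4\<close>, and
      \<open>g = 8 * r\<close> does the same for \<open>2 * r\<close>.\<close>
    have "(4 / real r) * (2 * (real k + 1) * real p * real g) * s \<le>
        (4 / real r) * (2 * (real k + 1) * real p * real g) * 2"
      using sum by (intro mult_left_mono) (auto simp: s_def)
    also have "\<dots> = real p * real g / 4" unfolding r by (simp add: field_simps)
    finally have 1: "(4 / real r) * real_of_int P * s \<le> real p * real g / 4" unfolding rP .
    have 2: "2 * real r \<le> real p * real g / 4"
      using p mult_right_mono[of 1 "real p" "2 * real r"] by (simp add: g_def)
    have "(s * (2 * (real k + 1)) * real p + real p / 2) * real g \<le>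
        (2 * real k * real h + real p) * real g"
      using dens by (intro mult_right_mono) (auto simp: s_def h_def)
    also have "\<dots> = real (2 * k * g * h + p * g)" by (simp add: algebra_simps)
    also have "\<dots> \<le> real (card S0)" using cS by (simp only: of_nat_le_iff)
    finally have 3: "real_of_int P * s + real p * real g / 2 \<le> real (card S0)"
      unfolding rP by (simp add: algebra_simps)
    have "(1 + 4 / real r) * real_of_int P * s + 2 * real r =
       (4 / real r) * real_of_int P * s + real_of_int P * s + 2 * real r"
      by (simp add: algebra_simps)
    then show "(1 + 4 / real r) * real_of_int P * (\<Sum>j\<in>J. 1 / b j) + 2 * real r \<le> real (card S0)"
      using 1 2 3 unfolding s_def by linarith
  qed
  then show ?thesis using serves_mono[OF _ per] by (simp add: H_def N_def)
qed

text \<open>One slot in each period \<open>P = 2 * (k + 1)\<close> is the case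
  \<open>u = n = 1\<close> of \<open>serves_periodic\<close>, and \<open>c = 6 * (k + 1)\<close>
  satisfies \<open>c - 2 * P = P\<close>. With mantissa \<open>1\<close>, rounding the periods down
  to \<open>c * 2 ^ e\<close> costs a factor of at most \<open>2\<close>, so that density
  \<open>1 / (2 * c)\<close> can be served.\<close>

lemma serves_medium:
  fixes k :: nat and b :: "'j \<Rightarrow> real"
  assumes k: "k \<ge> 1" and J: "finite J" "\<And>j. j \<in> J \<Longrightarrow> b j \<ge> 6 * (real k + 1)"
    and sum: "(\<Sum>j\<in>J. 1 / b j) \<le> 1 / (12 * (real k + 1))"
  shows "serves {t. t mod (2 * (int k + 1)) = int k} b J"
proof -
  define c where "c = 6 * (real k + 1)"
  have c: "c > 0" by (simp add: c_def)
  have grid: "\<exists>e x. 1 \<le> x \<and> x < 2 * (1::nat) \<and> real x * c * 2 ^ e \<le> b j \<and> b j < (real x + 1) * c * 2 ^ e"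
    if "j \<in> J" for j
    using J(2) that c by (intro dyadic_grid_cell) (auto simp: c_def)
  have "\<forall>j\<in>J. \<exists>e. c * 2 ^ e \<le> b j \<and> b j < 2 * c * 2 ^ e"
  proof (intro ballI)
    fix j assume "j \<in> J"
    then obtain e x where "1 \<le> x" "x < 2 * (1::nat)"
      "real x * c * 2 ^ e \<le> b j" "b j < (real x + 1) * c * 2 ^ e" using grid by blast
    moreover from this have "x = 1" by simp
    ultimately show "\<exists>e. c * 2 ^ e \<le> b j \<and> b j < 2 * c * 2 ^ e" by auto
  qed
  then obtain e where e: "\<And>j. j \<in> J \<Longrightarrow> c * 2 ^ e j \<le> b j" "\<And>j. j \<in> J \<Longrightarrow> b j < 2 * c * 2 ^ e j"
    by metis
  have "serves {t. t mod (2 * (int k + 1)) \<in> {int k}} b J"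
  proof (rule serves_periodic[where u = 1 and n = 1 and c = c and e = e])
    show "(\<Sum>j\<in>J. 1 / 2 ^ e j) \<le> real 1"
    proof -
      have "(\<Sum>j\<in>J. 1 / 2 ^ e j) \<le> (\<Sum>j\<in>J. 2 * c * (1 / b j))"
      proof (rule sum_mono)
        fix j assume j: "j \<in> J"
        have "b j > 0" using e(1)[OF j] c by (smt (verit) mult_pos_pos zero_less_power)
        then show "1 / 2 ^ e j \<le> 2 * c * (1 / b j)" using e(2)[OF j] by (simp add: field_simps)
      qed
      also have "\<dots> = 2 * c * (\<Sum>j\<in>J. 1 / b j)" by (simp add: sum_distrib_left)
      also have "\<dots> \<le> 2 * c * (1 / (12 * (real k + 1)))" using sum c by (intro mult_left_mono) auto
      also have "\<dots> = 1" by (simp add: c_def)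
      finally show ?thesis by simp
    qed
  qed (use e J in \<open>auto simp: c_def\<close>)
  then show ?thesis by simp
qed

section \<open>Density and multiplicities of an instance\<close>

definition density :: "nat list \<Rightarrow> nat set \<Rightarrow> real" where
  "density A V = (\<Sum>i\<in>{i. i < length A \<and> A ! i \<in> V}. 1 / real (A ! i))"

definition multiplicity_of :: "nat list \<Rightarrow> nat \<Rightarrow> nat" where
  "multiplicity_of A v = card {i. i < length A \<and> A ! i = v}"

lemma density_Un:
  assumes "V \<inter> W = {}"
  shows "density A (V \<union> W) = density A V + density A W"
proof -
  have "{i. i < length A \<and> A ! i \<in> V \<union> W} =
      {i. i < length A \<and> A ! i \<in> V} \<union> {i. i < length A \<and> A ! i \<in> W}" by auto
  then show ?thesis unfolding density_def
    using assms by (simp only:) (rule sum.union_disjoint; auto)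
qed

lemma density_mono: "V \<subseteq> W \<Longrightarrow> density A V \<le> density A W"
  unfolding density_def by (intro sum_mono2) auto

text \<open>A task of period \<open>a\<close> occupies at least \<open>L / a - 1\<close> slots of
  the window, and different tasks occupy different slots.\<close>

lemma scheduled_slots_ge:
  assumes \<sigma>: "\<And>i t L. i < length A \<Longrightarrow>
      \<lfloor>real L / real (A ! i)\<rfloor> \<le> int (card {u \<in> {t..<t + int L}. \<sigma> u = Some i})"
  shows "real L * density A V - real (length A) \<le>
    real (card {u \<in> {0..<int L}. \<exists>i. \<sigma> u = Some i \<and> i < length A \<and> A ! i \<in> V})"
proof -
  define I where "I = {i. i < length A \<and> A ! i \<in> V}"
  have I: "finite I" "card I \<le> length A"
    using card_mono[of "{..<length A}" I] by (auto simp: I_def)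
  have "real L * density A V - real (length A) \<le> (\<Sum>i\<in>I. real L / real (A ! i)) - real (card I)"
    using I(2) by (simp add: density_def I_def[symmetric] sum_distrib_left)
  also have "\<dots> = (\<Sum>i\<in>I. real L / real (A ! i) - 1)" by (simp add: sum_subtractf)
  also have "\<dots> \<le> (\<Sum>i\<in>I. real (card {u \<in> {0..<int L}. \<sigma> u = Some i}))"
  proof (rule sum_mono)
    fix i assume "i \<in> I"
    then have "\<lfloor>real L / real (A ! i)\<rfloor> \<le> int (card {u \<in> {0..<int L}. \<sigma> u = Some i})"
      using \<sigma>[of i L 0] by (simp add: I_def)
    then show "real L / real (A ! i) - 1 \<le> real (card {u \<in> {0..<int L}. \<sigma> u = Some i})"
      by linarith
  qed
  also have "\<dots> = real (card (\<Union>i\<in>I. {u \<in> {0..<int L}. \<sigma> u = Some i}))"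
    using I(1) by (subst card_UN_disjoint) (auto intro: finite_subset[of _ "{0..<int L}"])
  also have "(\<Union>i\<in>I. {u \<in> {0..<int L}. \<sigma> u = Some i}) =
      {u \<in> {0..<int L}. \<exists>i. \<sigma> u = Some i \<and> i < length A \<and> A ! i \<in> V}"
    by (auto simp: I_def)
  finally show ?thesis .
qed

lemma schedulable_obtains:
  assumes "schedulable (map real A)"
  obtains \<sigma> where "\<And>t i. \<sigma> t = Some i \<Longrightarrow> i < length A"
    "\<And>i t L. i < length A \<Longrightarrow>
      \<lfloor>real L / real (A ! i)\<rfloor> \<le> int (card {u \<in> {t..<t + int L}. \<sigma> u = Some i})"
proof -
  obtain \<sigma> where 1: "\<forall>t i. \<sigma> t = Some i \<longrightarrow> t \<in> UNIV \<and> i \<in> {..<length (map real A)}"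
    and 2: "\<forall>i\<in>{..<length (map real A)}. \<forall>t. \<forall>L::nat. \<lfloor>real L / map real A ! i\<rfloor> \<le>
      int (card {u \<in> {t..<t + int L}. \<sigma> u = Some i})"
    using assms unfolding schedulable_iff_serves serves_def by (elim exE conjE) (erule (1) that)
  show ?thesis
  proof
    show "i < length A" if "\<sigma> t = Some i" for t i using 1 that by auto
    show "\<lfloor>real L / real (A ! i)\<rfloor> \<le> int (card {u \<in> {t..<t + int L}. \<sigma> u = Some i})"
      if "i < length A" for i t L using 2[rule_format, of i L t] that by simp
  qed
qed

text \<open>The tasks take at least \<open>L * density A V - length A\<close> of \<open>L\<close>
  slots; for density above \<open>1\<close> this exceeds \<open>L\<close> once \<open>L\<close> is
  large.\<close>

lemma schedulable_density_le_1:
  assumes "schedulable (map real A)"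
  shows "density A V \<le> 1"
proof (rule ccontr)
  assume "\<not> density A V \<le> 1"
  then have d: "density A V - 1 > 0" by simp
  obtain \<sigma> where \<sigma>: "\<And>i t L. i < length A \<Longrightarrow>
      \<lfloor>real L / real (A ! i)\<rfloor> \<le> int (card {u \<in> {t..<t + int L}. \<sigma> u = Some i})"
    using schedulable_obtains[OF assms] by metis
  obtain L :: nat where L: "real (length A) < real L * (density A V - 1)"
    using reals_Archimedean3[OF d] by blast
  have "card {u \<in> {0..<int L}. \<exists>i. \<sigma> u = Some i \<and> i < length A \<and> A ! i \<in> V} \<le> card {0..<int L}"
    by (intro card_mono) auto
  then have "real L * density A V - real (length A) \<le> real L"
    using scheduled_slots_ge[of A \<sigma> L V, OF \<sigma>] by simp
  then show False using L by (simp add: algebra_simps)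
qed

text \<open>For each period in \<open>V\<close> there is a bijection between the tasks having it in
  the two instances; these are glued together.\<close>

lemma equal_multiplicities_bij:
  assumes "\<And>v. v \<in> V \<Longrightarrow> multiplicity_of A v = multiplicity_of A' v"
  obtains \<pi> where "bij_betw \<pi> {i. i < length A' \<and> A' ! i \<in> V} {i. i < length A \<and> A ! i \<in> V}"
    "\<And>i. i < length A' \<Longrightarrow> A' ! i \<in> V \<Longrightarrow> A ! \<pi> i = A' ! i"
proof -
  let ?I = "\<lambda>B v. {i. i < length B \<and> B ! i = v}"
  have "\<exists>f. bij_betw f (?I A' v) (?I A v)" if "v \<in> V" for v
    using assms[OF that] unfolding multiplicity_of_def by (intro finite_same_card_bij) auto
  then obtain f where f: "\<And>v. v \<in> V \<Longrightarrow> bij_betw (f v) (?I A' v) (?I A v)" by metis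
  define \<pi> where "\<pi> i = f (A' ! i) i" for i
  have im: "\<pi> i < length A \<and> A ! \<pi> i = A' ! i" if "i < length A'" "A' ! i \<in> V" for i
    using bij_betwE[OF f[OF that(2)]] that by (auto simp: \<pi>_def)
  show ?thesis
  proof
    show "bij_betw \<pi> {i. i < length A' \<and> A' ! i \<in> V} {i. i < length A \<and> A ! i \<in> V}"
      unfolding bij_betw_def
    proof (intro conjI inj_onI set_eqI iffI)
      fix i j assume i: "i \<in> {i. i < length A' \<and> A' ! i \<in> V}" and j: "j \<in> {i. i < length A' \<and> A' ! i \<in> V}"
        and eq: "\<pi> i = \<pi> j"
      then have "A' ! i = A' ! j" using im by (metis mem_Collect_eq)
      then show "i = j"
        using eq i j f[of "A' ! i"] unfolding \<pi>_def bij_betw_def inj_on_def by auto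
    next
      fix l assume "l \<in> {i. i < length A \<and> A ! i \<in> V}"
      then have "l \<in> ?I A (A ! l)" "A ! l \<in> V" by auto
      then have "l \<in> f (A ! l) ` ?I A' (A ! l)" using f[of "A ! l"] by (simp add: bij_betw_def)
      then obtain i where i: "i \<in> ?I A' (A ! l)" "f (A ! l) i = l" by (elim imageE) simp
      then show "l \<in> \<pi> ` {i. i < length A' \<and> A' ! i \<in> V}"
        using \<open>A ! l \<in> V\<close> by (intro image_eqI[of _ _ i]) (auto simp: \<pi>_def)
    qed (use im in auto)
  qed (use im in auto)
qed

lemma density_cong:
  assumes "\<And>v. v \<in> V \<Longrightarrow> multiplicity_of A v = multiplicity_of A' v"
  shows "density A' V = density A V"
proof -
  obtain \<pi> where \<pi>: "bij_betw \<pi> {i. i < length A' \<and> A' ! i \<in> V} {i. i < length A \<and> A ! i \<in> V}"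
    "\<And>i. i < length A' \<Longrightarrow> A' ! i \<in> V \<Longrightarrow> A ! \<pi> i = A' ! i"
    by (rule equal_multiplicities_bij[of V A A']) (use assms in simp, rule that)
  show ?thesis
    unfolding density_def sum.reindex_bij_betw[OF \<pi>(1), symmetric] by (intro sum.cong) (auto simp: \<pi>(2))
qed

text \<open>The factor after the first \<open>2 * r\<close>, with \<open>r = 64 * (k + 1)\<close>, bounds the period of the slots for the
  long tasks: \<open>(threshold k j + 1) ^ threshold k j\<close> bounds the period of the short tasks' schedule.\<close>
fun threshold :: "nat \<Rightarrow> nat \<Rightarrow> nat" where
  "threshold k 0 = 6 * (k + 1)"
| "threshold k (Suc j) =
     2 * (64 * (k + 1)) * (2 * (k + 1) * (threshold k j + 1) ^ threshold k j * (8 * (64 * (k + 1))))"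

lemma threshold_pos: "threshold k j > 0"
  by (induction j) auto

lemma threshold_Suc: "threshold k j \<le> threshold k (Suc j)"
proof -
  let ?K = "threshold k j"
  have "?K + 1 \<le> (?K + 1) ^ ?K" using threshold_pos[of k j] by (intro self_le_power) auto
  also have "\<dots> \<le> (?K + 1) ^ ?K * (2048 * (64 * (k + 1)) * (k + 1) * (k + 1))" by simp
  also have "\<dots> = threshold k (Suc j)" by (simp only: threshold.simps mult_ac)
  finally show ?thesis by simp
qed

lemma threshold_mono: "i \<le> j \<Longrightarrow> threshold k i \<le> threshold k j"
  by (rule lift_Suc_mono_le[of "threshold k"]) (rule threshold_Suc)

text \<open>The \<open>R\<close> ranges are disjoint, so their densities add up to at most
  \<open>1\<close>, and one of them has at most the average.\<close>

lemma sparse_range: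
  assumes "density A UNIV \<le> 1" "R > 0"
  shows "\<exists>j<R. density A {threshold k j<..threshold k (Suc j)} \<le> 1 / real R"
proof (rule ccontr)
  assume "\<not> ?thesis"
  then have "(\<Sum>j<R. 1 / real R) < (\<Sum>j<R. density A {threshold k j<..threshold k (Suc j)})"
    using assms(2) by (intro sum_strict_mono) auto
  also have "\<dots> \<le> density A {..threshold k R}"
  proof (induction R)
    case 0
    show ?case by (simp add: density_def sum_nonneg)
  next
    case (Suc n)
    have "{..threshold k (Suc n)} = {..threshold k n} \<union> {threshold k n<..threshold k (Suc n)}"
      using threshold_Suc[of k n] by auto
    then have "density A {..threshold k (Suc n)} =
        density A {..threshold k n} + density A {threshold k n<..threshold k (Suc n)}"
      by (simp only:) (rule density_Un; auto)
    then show ?case using Suc by simp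
  qed
  also have "\<dots> \<le> density A UNIV" by (rule density_mono) simp
  finally show False using assms by simp
qed

text \<open>The tasks of \<open>A'\<close> are split by period: those up to \<open>K\<close> follow
  the periodic schedule obtained from \<open>A\<close> on the old slots, those in the sparse range
  use \<open>mid\<close>, and those above \<open>K'\<close> use \<open>free\<close>. The density
  above \<open>K'\<close> may grow by \<open>1 / (8 * k)\<close> from \<open>A\<close> to
  \<open>A'\<close>, and another \<open>1 / (8 * k)\<close> is given up in \<open>\<rho>\<close>.
  Together they cost half of the new slots in \<open>free\<close>; the other half is the slack
  required by \<open>serves_in_free_slots\<close>.\<close>

lemma stretched_schedulable_if_similar:
  fixes k :: nat
  assumes k: "k \<ge> 1" and A: "schedulable (map real A)" "\<forall>a\<in>set A. a > 0"
    and A': "\<forall>a\<in>set A'. a > 0"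
    and same: "\<And>v. v \<le> threshold k (12 * (k + 1)) \<Longrightarrow> multiplicity_of A v = multiplicity_of A' v"
    and close: "density A' UNIV \<le> density A UNIV + 1 / (8 * real k)"
  shows "serves UNIV (\<lambda>i. (1 + 1 / real k) * real (A' ! i)) {..<length A'}"
proof -
  define b where "b i = (1 + 1 / real k) * real (A' ! i)" for i
  \<comment> \<open>The average density \<open>1 / R\<close> is what \<open>serves_medium\<close>
    admits.\<close>
  define R where "R = 12 * (k + 1)"
  have dA: "density A V \<le> 1" for V using A(1) by (rule schedulable_density_le_1)
  obtain j where j: "j < R" "density A {threshold k j<..threshold k (Suc j)} \<le> 1 / real R"
    using sparse_range[OF dA, of R] by (auto simp: R_def)
  define K where "K = threshold k j"
  define K' where "K' = threshold k (Suc j)"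
  have K: "K > 0" "K \<le> K'" unfolding K_def K'_def by (rule threshold_pos, rule threshold_Suc)
  have K'R: "K' \<le> threshold k R" unfolding K'_def using j(1) by (intro threshold_mono) simp
  have same': "multiplicity_of A v = multiplicity_of A' v" if "v \<le> K'" for v
    using same that K'R by (simp add: R_def)
  obtain \<sigma> where \<sigma>1: "\<And>t i. \<sigma> t = Some i \<Longrightarrow> i < length A" and \<sigma>2: "\<And>i t L. i < length A \<Longrightarrow>
      \<lfloor>real L / real (A ! i)\<rfloor> \<le> int (card {u \<in> {t..<t + int L}. \<sigma> u = Some i})"
    using schedulable_obtains[OF A(1)] by metis
  \<comment> \<open>\<open>big\<close> refers to the share of the slots, hence to short
    periods.\<close>
  define big where "big B = {i. i < length B \<and> B ! i \<in> {..K}}" for B :: "nat list"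
  define \<sigma>b where "\<sigma>b t = (case \<sigma> t of Some i \<Rightarrow> if A ! i \<le> K then Some i else None | None \<Rightarrow> None)" for t
  define sA where "sA = density A {K'<..}"
  define \<rho> where "\<rho> = sA - 1 / (8 * real k)"
  define M where "M = (K + 1) ^ K"
  have k8: "1 / (8 * real k) > 0" "1 / (8 * real k) \<le> 1" using k by simp_all
  \<comment> \<open>The margin \<open>1 / (8 * k)\<close> in \<open>\<rho>\<close> grows with the
    window and outweighs the \<open>length A\<close> rounding errors and twice the bound
    \<open>M\<close> on the number of states.\<close>
  obtain L :: nat where L: "real (length A) + 2 * real M < real L * (1 / (8 * real k))"
    using reals_Archimedean3[OF k8(1)] by blast
  have win: "\<exists>u\<in>{t..<t + int (A ! i)}. \<sigma>b u = Some i" if i: "i \<in> big A" for i t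
  proof -
    have "i < length A" "A ! i > 0" using i A(2) by (auto simp: big_def)
    then have "card {u \<in> {t..<t + int (A ! i)}. \<sigma> u = Some i} \<noteq> 0"
      using \<sigma>2[of i "A ! i" t] by auto
    then have "{u \<in> {t..<t + int (A ! i)}. \<sigma> u = Some i} \<noteq> {}" by (metis card.empty)
    then obtain u where "u \<in> {t..<t + int (A ! i)}" "\<sigma> u = Some i" by blast
    then show ?thesis using i by (intro bexI[of _ u]) (auto simp: \<sigma>b_def big_def)
  qed
  have hol: "2 * real ((K + 1) ^ K) < real (card {t \<in> {0..<int L}. \<sigma>b t = None}) - \<rho> * real L"
  proof -
    have "card {u \<in> {0..<int L}. \<exists>i. \<sigma> u = Some i \<and> i < length A \<and> A ! i \<in> {K'<..}} \<le>
        card {t \<in> {0..<int L}. \<sigma>b t = None}"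
      using K(2) by (intro card_mono) (auto simp: \<sigma>b_def intro: finite_subset[of _ "{0..<int L}"])
    then have "real L * sA - real (length A) \<le> real (card {t \<in> {0..<int L}. \<sigma>b t = None})"
      using scheduled_slots_ge[of A \<sigma> L "{K'<..}", OF \<sigma>2] unfolding sA_def by linarith
    then show ?thesis using L by (simp add: \<rho>_def M_def algebra_simps)
  qed
  obtain \<tau> p where \<tau>: "0 < p" "p \<le> M" "\<And>t. \<tau> (t + int p) = \<tau> t"
    "\<And>i t. i \<in> big A \<Longrightarrow> \<exists>u\<in>{t..<t + int (A ! i)}. \<tau> u = Some i"
    "\<rho> * real p \<le> real (card {t \<in> {0..<int p}. \<tau> t = None})"
  proof (rule periodic_schedule[of K "big A" "(!) A" \<sigma>b \<rho> L])
    show "\<sigma>b t \<in> insert None (Some ` big A)" for t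
      using \<sigma>1[of t] by (auto simp: \<sigma>b_def big_def split: option.splits)
    have "sA \<ge> 0" by (simp add: sA_def density_def sum_nonneg)
    then show "\<rho> \<ge> -1" using k8 unfolding \<rho>_def by linarith
  qed (use K win hol in \<open>auto simp: big_def M_def\<close>)
  define h where "h = card {t \<in> {0..<int p}. \<tau> t = None}"
  obtain \<pi> where \<pi>: "bij_betw \<pi> (big A') (big A)"
    "\<And>i. i < length A' \<Longrightarrow> A' ! i \<in> {..K} \<Longrightarrow> A ! \<pi> i = A' ! i"
    using equal_multiplicities_bij[of "{..K}" A A'] same' K(2) unfolding big_def by auto
  define old where "old = {t. t mod (int k + 1) \<noteq> int k \<and> \<tau> (old_time (int k) t) \<noteq> None}"
  define free where "free = {t. t mod (int k + 1) \<noteq> int k \<and> \<tau> (old_time (int k) t) = None} \<union>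
      {t. t mod (2 * (int k + 1)) = 2 * int k + 1}"
  define mid where "mid = {t. t mod (2 * (int k + 1)) = int k}"
  define med where "med = {i. i < length A' \<and> A' ! i \<in> {K<..K'}}"
  define lng where "lng = {i. i < length A' \<and> A' ! i \<in> {K'<..}}"
  have b_ge: "b i \<ge> real (A' ! i)" for i by (simp add: b_def mult_left_le_one_le field_simps)
  have inv_b: "1 / b i = real k / (real k + 1) * (1 / real (A' ! i))" for i
    using k by (simp add: b_def field_simps)
  have sum_b: "(\<Sum>i\<in>{i. i < length A' \<and> A' ! i \<in> V}. 1 / b i) = real k / (real k + 1) * density A' V" for V
    unfolding inv_b density_def by (simp add: sum_distrib_left)
  have sum_b_le: "(\<Sum>i\<in>{i. i < length A' \<and> A' ! i \<in> V}. 1 / b i) \<le> density A' V" for V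
  proof -
    have "0 \<le> density A' V" by (simp add: density_def sum_nonneg)
    then show ?thesis unfolding sum_b by (intro mult_left_le_one_le) (simp_all add: field_simps)
  qed
  have s1: "serves old b (big A')"
    unfolding old_def b_def
  proof (rule serves_stretched[OF k, where \<pi> = \<pi>])
    show "inj_on \<pi> (big A')" using \<pi>(1) by (simp add: bij_betw_def)
    show "A' ! i > 0" if "i \<in> big A'" for i using that A' by (auto simp: big_def)
    show "\<exists>u\<in>{t..<t + int (A' ! i)}. \<tau> u = Some (\<pi> i)" if "i \<in> big A'" for i t
    proof -
      have "\<pi> i \<in> big A" using \<pi>(1) that by (metis bij_betwE)
      then show ?thesis using \<tau>(4)[of "\<pi> i" t] \<pi>(2)[of i] that by (simp add: big_def)
    qed
  qed
  have s2: "serves mid b med"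
    unfolding mid_def
  proof (rule serves_medium[OF k])
    have "threshold k 0 \<le> K" unfolding K_def by (rule threshold_mono) simp
    then have "6 * (k + 1) \<le> K" by simp
    then have "real (6 * (k + 1)) \<le> real K" by (simp only: of_nat_le_iff)
    then show "6 * (real k + 1) \<le> b i" if "i \<in> med" for i
      using that b_ge[of i] by (auto simp: med_def)
    have "density A' {K<..K'} = density A {K<..K'}" using same' by (intro density_cong) auto
    then show "(\<Sum>i\<in>med. 1 / b i) \<le> 1 / (12 * (real k + 1))"
      using sum_b_le[of "{K<..K'}"] j(2) by (simp add: med_def R_def K_def K'_def algebra_simps)
  qed (simp add: med_def)
  have s3: "serves free b lng"
    unfolding free_def
  proof (rule serves_in_free_slots[where \<tau> = \<tau> and p = p and r = "64 * (k + 1)", OF k \<tau>(1) \<tau>(3)])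
    have "2 * (64 * (k + 1)) * (2 * (k + 1) * p * (8 * (64 * (k + 1)))) \<le> K'"
      using \<tau>(2) unfolding K'_def threshold.simps K_def[symmetric] M_def[symmetric]
      by (intro mult_le_mono) auto
    then have le: "real (2 * (64 * (k + 1)) * (2 * (k + 1) * p * (8 * (64 * (k + 1))))) \<le> real K'"
      by (simp only: of_nat_le_iff)
    show "real (2 * (64 * (k + 1)) * (2 * (k + 1) * p * (8 * (64 * (k + 1))))) \<le> b i" if "i \<in> lng" for i
    proof -
      have "real K' \<le> real (A' ! i)" using that by (simp add: lng_def)
      then show ?thesis using le b_ge[of i] by linarith
    qed
    have split: "density B UNIV = density B {..K'} + density B {K'<..}" for B
    proof -
      have "UNIV = {..K'} \<union> {K'<..}" by auto
      moreover have "density B ({..K'} \<union> {K'<..}) = density B {..K'} + density B {K'<..}"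
        by (rule density_Un) auto
      ultimately show ?thesis by simp
    qed
    \<comment> \<open>The periods up to \<open>K'\<close> contribute equally to both instances, so
      the whole difference in density belongs to the long periods.\<close>
    have "density A' {..K'} = density A {..K'}" using same' by (intro density_cong) auto
    then have sB: "density A' {K'<..} \<le> sA + 1 / (8 * real k)"
      using close split[of A] split[of A'] by (simp add: sA_def)
    then show "(\<Sum>i\<in>lng. 1 / b i) \<le> 2"
      using sum_b_le[of "{K'<..}"] dA[of "{K'<..}"] k8 unfolding lng_def sA_def by linarith
    have "(\<Sum>i\<in>lng. 1 / b i) * (2 * (real k + 1)) * real p = 2 * real k * density A' {K'<..} * real p"
      unfolding lng_def sum_b by (simp add: field_simps)
    also have "\<dots> \<le> 2 * real k * (\<rho> + 1 / (4 * real k)) * real p"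
      using sB by (intro mult_right_mono mult_left_mono) (simp_all add: \<rho>_def)
    also have "\<dots> = 2 * real k * (\<rho> * real p) + real p / 2"
      using k by (simp add: field_simps)
    also have "\<dots> \<le> 2 * real k * real h + real p / 2"
      using \<tau>(5) by (intro add_right_mono mult_left_mono) (simp_all add: h_def)
    finally show "(\<Sum>i\<in>lng. 1 / b i) * (2 * (real k + 1)) * real p + real p / 2 \<le>
        2 * real k * real (card {t \<in> {0..<int p}. \<tau> t = None}) + real p"
      by (simp add: h_def)
  qed (auto simp: lng_def)
  have new: "t mod (int k + 1) = int k" if "t mod (2 * (int k + 1)) \<in> {int k, 2 * int k + 1}" for t
  proof -
    have "t mod (2 * (int k + 1)) mod (int k + 1) = t mod (int k + 1)"
      by (rule mod_mod_cancel) (rule dvd_triv_right)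
    moreover have "(2 * int k + 1) mod (int k + 1) = int k"
    proof -
      have "2 * int k + 1 = int k + (int k + 1) * 1" by simp
      then show ?thesis by (simp only: mod_mult_self2) simp
    qed
    ultimately show ?thesis using that by auto
  qed
  have "serves (old \<union> mid \<union> free) b (big A' \<union> med \<union> lng)"
  proof (intro serves_Un s1 s2 s3)
    show "old \<inter> mid = {}" using new by (auto simp: old_def mid_def)
    show "(old \<union> mid) \<inter> free = {}" using new k by (fastforce simp: old_def mid_def free_def)
  qed (use K in \<open>auto simp: big_def med_def lng_def\<close>)
  moreover have "big A' \<union> med \<union> lng = {..<length A'}" by (auto simp: big_def med_def lng_def)
  ultimately show ?thesis using serves_mono[of _ _ _ UNIV] by (auto simp: b_def[abs_def])
qed

section \<open>The random access machine\<close>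

text \<open>Total correctness with a step budget, for a given start state rather than a
  precondition, so that \<open>Q\<close> can refer to the initial contents.\<close>

definition exec :: "program \<Rightarrow> memory \<Rightarrow> nat \<Rightarrow> (memory \<Rightarrow> bool) \<Rightarrow> bool" where
  "exec P s n Q \<longleftrightarrow> (\<exists>t s'. run P s t s' \<and> t \<le> n \<and> Q s')"

lemma exec_mono:
  assumes "exec P s n Q" "n \<le> n'" "\<And>s'. Q s' \<Longrightarrow> Q' s'"
  shows "exec P s n' Q'"
  using assms unfolding exec_def by (meson order_trans)

text \<open>The closing \<open>Skip\<close> costs one step, which appears in the step budgets
  below.\<close>

fun block :: "program list \<Rightarrow> program" where
  "block [] = Skip"
| "block (P # Ps) = Seq P (block Ps)"

lemma exec_basic:
  assumes "1 \<le> n"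
  shows "Q s \<Longrightarrow> exec Skip s n Q"
    and "Q (s(i := c)) \<Longrightarrow> exec (Set_Const i c) s n Q"
    and "Q (s(i := s j + s k)) \<Longrightarrow> exec (Add i j k) s n Q"
    and "Q (s(i := s j - s k)) \<Longrightarrow> exec (Sub i j k) s n Q"
    and "Q (s(i := s (s j))) \<Longrightarrow> exec (Load i j) s n Q"
  using assms unfolding exec_def by (blast intro: run.intros)+

lemma exec_Seq:
  assumes "exec P s n1 R" "\<And>s'. R s' \<Longrightarrow> exec P' s' (n - n1) Q" "n1 \<le> n"
  shows "exec (Seq P P') s n Q"
proof -
  obtain t s' where 1: "run P s t s'" "t \<le> n1" "R s'" using assms(1) unfolding exec_def by blast
  obtain u s'' where 2: "run P' s' u s''" "u \<le> n - n1" "Q s''"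
    using assms(2)[OF 1(3)] unfolding exec_def by blast
  have "t + u \<le> n" using 1 2 assms(3) by linarith
  then show ?thesis using run.Seq[OF 1(1) 2(1)] 2(3) unfolding exec_def by blast
qed

lemma exec_block_Cons:
  assumes "exec P s n1 R" "\<And>s'. R s' \<Longrightarrow> exec (block Ps) s' (n - n1) Q" "n1 \<le> n"
  shows "exec (block (P # Ps)) s n Q"
  using exec_Seq[OF assms] by simp

lemma exec_block_basic:
  assumes "1 \<le> n"
  shows "exec (block Ps) (s(i := c)) (n - 1) Q \<Longrightarrow> exec (block (Set_Const i c # Ps)) s n Q"
    and "exec (block Ps) (s(i := s j + s k)) (n - 1) Q \<Longrightarrow> exec (block (Add i j k # Ps)) s n Q"
    and "exec (block Ps) (s(i := s j - s k)) (n - 1) Q \<Longrightarrow> exec (block (Sub i j k # Ps)) s n Q"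
    and "exec (block Ps) (s(i := s (s j))) (n - 1) Q \<Longrightarrow> exec (block (Load i j # Ps)) s n Q"
proof -
  have *: "exec (block (P # Ps)) s n Q" if "exec (block Ps) s' (n - 1) Q" "exec P s 1 ((=) s')" for P s'
    by (rule exec_block_Cons[OF that(2)]) (use that(1) assms in auto)
  show "exec (block Ps) (s(i := c)) (n - 1) Q \<Longrightarrow> exec (block (Set_Const i c # Ps)) s n Q"
    and "exec (block Ps) (s(i := s j + s k)) (n - 1) Q \<Longrightarrow> exec (block (Add i j k # Ps)) s n Q"
    and "exec (block Ps) (s(i := s j - s k)) (n - 1) Q \<Longrightarrow> exec (block (Sub i j k # Ps)) s n Q"
    and "exec (block Ps) (s(i := s (s j))) (n - 1) Q \<Longrightarrow> exec (block (Load i j # Ps)) s n Q"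
    by (erule *, rule exec_basic; simp)+
qed

lemma exec_If:
  assumes "1 \<le> n" "s i > 0 \<Longrightarrow> exec P s (n - 1) Q" "\<not> s i > 0 \<Longrightarrow> exec P' s (n - 1) Q"
  shows "exec (If_Pos i P P') s n Q"
proof (cases "s i > 0")
  case True
  then obtain t s' where "run P s t s'" "t \<le> n - 1" "Q s'" using assms unfolding exec_def by blast
  then show ?thesis using run.If_True[of s i, OF True] assms(1) unfolding exec_def
    by (intro exI[of _ "Suc t"] exI[of _ s']) auto
next
  case False
  then obtain t s' where "run P' s t s'" "t \<le> n - 1" "Q s'" using assms unfolding exec_def by blast
  then show ?thesis using run.If_False[of s i, OF False] assms(1) unfolding exec_def
    by (intro exI[of _ "Suc t"] exI[of _ s']) auto
qed

text \<open>\<open>I j\<close> is the invariant after \<open>j\<close> rounds, and \<open>k\<close>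
  is their exact number. The two summands \<open>1\<close> in the budget are the test before each
  round and the final failing test.\<close>

lemma exec_While:
  assumes "\<And>j s. j < k \<Longrightarrow> I j s \<Longrightarrow> s x > 0 \<and> exec P s c (I (Suc j))"
    and "\<And>s. I k s \<Longrightarrow> \<not> s x > 0"
    and "I 0 s" and "k * (c + 1) + 1 \<le> n"
  shows "exec (While_Pos x P) s n (I k)"
proof -
  have "\<exists>t s'. run (While_Pos x P) s t s' \<and> t \<le> (k - j) * (c + 1) + 1 \<and> I k s'" if "j \<le> k" "I j s" for j s
    using that
  proof (induction "k - j" arbitrary: j s)
    case 0
    then have "I k s" by simp
    then show ?case using assms(2) run.While_False[of s x P] by (intro exI[of _ 1] exI[of _ s]) auto
  next
    case (Suc d)
    then have j: "j < k" by simp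
    obtain t s' where 1: "run P s t s'" "t \<le> c" "I (Suc j) s'" and pos: "s x > 0"
      using assms(1)[OF j Suc.prems(2)] unfolding exec_def by blast
    have "d = k - Suc j" using Suc.hyps(2) by simp
    then obtain u s'' where 2: "run (While_Pos x P) s' u s''" "u \<le> (k - Suc j) * (c + 1) + 1" "I k s''"
      using Suc.hyps(1)[of "Suc j" s'] 1(3) j by auto
    have "k - j = Suc (k - Suc j)" using j by simp
    then have "Suc (t + u) \<le> (k - j) * (c + 1) + 1" using 1(2) 2(2) by simp
    then show ?case using run.While_True[OF pos 1(1) 2(1)] 2(3) by blast
  qed
  then show ?thesis using assms(3,4) unfolding exec_def by (metis diff_zero le0 order_trans)
qed

text \<open>Table lookup as nested tests. All arguments from \<open>B\<close> on share the entry
  \<open>f B\<close>, which bounds the time by a constant even for huge arguments.\<close>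

fun dispatch :: "nat \<Rightarrow> (nat \<Rightarrow> int) \<Rightarrow> program" where
  "dispatch 0 f = Set_Const (- 6) (f 0)"
| "dispatch (Suc B) f =
     If_Pos (- 5) (Seq (Sub (- 5) (- 5) (- 1)) (dispatch B (f \<circ> Suc))) (Set_Const (- 6) (f 0))"

lemma exec_dispatch:
  assumes "s (- 1) = 1" "s (- 5) = int v" "2 * B + 1 \<le> n"
  shows "exec (dispatch B f) s n
    (\<lambda>s'. s' (- 6) = f (min v B) \<and> (\<forall>c. c \<noteq> - 5 \<longrightarrow> c \<noteq> - 6 \<longrightarrow> s' c = s c))"
  using assms
proof (induction B arbitrary: f s v n)
  case 0
  then show ?case by (auto intro!: exec_basic)
next
  case (Suc B)
  show ?case
    unfolding dispatch.simps
  proof (rule exec_If)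
    assume "s (- 5) > 0"
    then obtain v' where v: "v = Suc v'" using Suc.prems by (cases v) auto
    show "exec (Seq (Sub (- 5) (- 5) (- 1)) (dispatch B (f \<circ> Suc))) s (n - 1)
        (\<lambda>s'. s' (- 6) = f (min v (Suc B)) \<and> (\<forall>c. c \<noteq> - 5 \<longrightarrow> c \<noteq> - 6 \<longrightarrow> s' c = s c))"
    proof (rule exec_Seq[where ?n1.0 = 1 and R = "\<lambda>s'. s' = s(- 5 := int v')"])
      fix s' assume "s' = s(- 5 := int v')"
      then have s': "s' (- 1) = 1" "s' (- 5) = int v'" "\<And>c. c \<noteq> - 5 \<Longrightarrow> s' c = s c"
        using Suc.prems by auto
      have "exec (dispatch B (f \<circ> Suc)) s' (n - 1 - 1)
          (\<lambda>t. t (- 6) = (f \<circ> Suc) (min v' B) \<and> (\<forall>c. c \<noteq> - 5 \<longrightarrow> c \<noteq> - 6 \<longrightarrow> t c = s' c))"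
        using Suc.prems(3) by (intro Suc.IH s') simp
      then show "exec (dispatch B (f \<circ> Suc)) s' (n - 1 - 1)
          (\<lambda>s'. s' (- 6) = f (min v (Suc B)) \<and> (\<forall>c. c \<noteq> - 5 \<longrightarrow> c \<noteq> - 6 \<longrightarrow> s' c = s c))"
        using s'(3) v by simp
    qed (use Suc.prems v in \<open>auto intro!: exec_basic\<close>)
  next
    assume "\<not> s (- 5) > 0"
    then have "v = 0" using Suc.prems by simp
    then show "exec (Set_Const (- 6) (f 0)) s (n - 1)
        (\<lambda>s'. s' (- 6) = f (min v (Suc B)) \<and> (\<forall>c. c \<noteq> - 5 \<longrightarrow> c \<noteq> - 6 \<longrightarrow> s' c = s c))"
      using Suc.prems by (auto intro!: exec_basic)
  qed (use Suc.prems in auto)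
qed

definition division_loop :: "int \<Rightarrow> int \<Rightarrow> int \<Rightarrow> program" where
  "division_loop x q d = While_Pos x (Seq (Add q q (- 1)) (Sub x x d))"

text \<open>The loop variable holds the current remainder minus \<open>d - 1\<close>.\<close>
lemma exec_division_loop:
  assumes "s (- 1) = 1" "s x = int y - int d + 1" "s r = int d" "d > 0"
    and "distinct [x, q, r, - 1]" "3 * (y div d) + 1 \<le> n"
  shows "exec (division_loop x q r) s n
    (\<lambda>s'. s' q = s q + int (y div d) \<and> (\<forall>c. c \<noteq> x \<longrightarrow> c \<noteq> q \<longrightarrow> s' c = s c))"
proof -
  define I where "I j s' \<longleftrightarrow> s' x = int y - int d + 1 - int (j * d) \<and> s' q = s q + int j \<and>
    (\<forall>c. c \<noteq> x \<longrightarrow> c \<noteq> q \<longrightarrow> s' c = s c)" for j s'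
  have "exec (division_loop x q r) s n (I (y div d))"
    unfolding division_loop_def
  proof (rule exec_While[where c = 2])
    fix j s' assume j: "j < y div d" and I: "I j s'"
    have "Suc j * d \<le> y div d * d" using j by (intro mult_le_mono1) simp
    also have "\<dots> \<le> y" by simp
    finally have "int (Suc j * d) \<le> int y" by (simp only: of_nat_le_iff)
    then have "s' x > 0" using I unfolding I_def by simp
    moreover have "exec (Seq (Add q q (- 1)) (Sub x x r)) s' 2 (I (Suc j))"
    proof (rule exec_Seq[where ?n1.0 = 1 and R = "\<lambda>t. t = s'(q := s' q + s' (- 1))"])
      fix t assume "t = s'(q := s' q + s' (- 1))"
      then show "exec (Sub x x r) t (2 - 1) (I (Suc j))"
        using I assms(1,3,5) unfolding I_def by (intro exec_basic(4)) (auto simp: algebra_simps)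
    qed (auto intro!: exec_basic)
    ultimately show "s' x > 0 \<and> exec (Seq (Add q q (- 1)) (Sub x x r)) s' 2 (I (Suc j))" by simp
  next
    fix s' assume "I (y div d) s'"
    moreover have "y < y div d * d + d" using assms(4) by (metis add.commute div_mult_mod_eq nat_add_left_cancel_less mod_less_divisor)
    then have "int y < int (y div d * d) + int d" by linarith
    ultimately show "\<not> s' x > 0" unfolding I_def by linarith
  qed (use assms in \<open>auto simp: I_def\<close>)
  then show ?thesis unfolding I_def exec_def by blast
qed

lemma exec_replicate_Add:
  assumes "distinct [x, y]" "N + 1 \<le> n"
  shows "exec (block (replicate N (Add x x y))) s n (\<lambda>s'. s' = s(x := s x + int N * s y))"
  using assms(2)
proof (induction N arbitrary: s n)
  case 0
  then show ?case by (auto intro!: exec_basic)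
next
  case (Suc N)
  have "exec (block (replicate N (Add x x y))) (s(x := s x + s y)) (n - 1)
      (\<lambda>s'. s' = s(x := s x + int (Suc N) * s y))"
  proof -
    have "(s(x := s x + s y))(x := (s(x := s x + s y)) x + int N * (s(x := s x + s y)) y) =
        s(x := s x + int (Suc N) * s y)"
      using assms(1) by (auto simp: algebra_simps)
    moreover have "N + 1 \<le> n - 1" using Suc.prems by simp
    ultimately show ?thesis using Suc.IH[of "n - 1" "s(x := s x + s y)"] by metis
  qed
  then show ?case unfolding replicate_Suc by (rule exec_block_basic(2)[rotated]) (use Suc.prems in simp)
qed

text \<open>Cell \<open>0\<close> is counter and address at once: with value \<open>i\<close> it
  points to the period in cell \<open>i\<close>, so the tasks are treated from last to
  first.\<close>

definition loop_body :: "nat \<Rightarrow> (nat \<Rightarrow> int) \<Rightarrow> program" where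
  "loop_body K w = block [Load (- 4) 0, Load (- 5) 0, dispatch K w, Add (- 10) (- 10) (- 6),
     Sub (- 7) (- 3) (- 4), Add (- 7) (- 7) (- 1), division_loop (- 7) (- 8) (- 4), Sub 0 0 (- 1)]"

text \<open>The quotient is at most \<open>y\<close> for every positive period, which makes the step
  bound independent of \<open>a\<close>.\<close>

lemma exec_loop_body:
  assumes "s (- 1) = 1" "s (- 3) = int y" "s (s 0) = int a" "a > 0" "s 0 > 0"
    and "2 * K + 3 * y + 10 \<le> n"
  shows "exec (loop_body K w) s n (\<lambda>s'. s' 0 = s 0 - 1 \<and> s' (- 8) = s (- 8) + int (y div a) \<and>
    s' (- 10) = s (- 10) + w (min a K) \<and> (\<forall>c. c > 0 \<or> c \<in> {-3..-1} \<or> c = - 9 \<longrightarrow> s' c = s c))"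
    (is "exec _ _ _ ?Q")
proof -
  have "y div a \<le> y" by simp
  then have n: "2 * K + 3 * (y div a) + 10 \<le> n" using assms(6) by linarith
  have 2: "exec (block [Add (- 10) (- 10) (- 6), Sub (- 7) (- 3) (- 4), Add (- 7) (- 7) (- 1),
      division_loop (- 7) (- 8) (- 4), Sub 0 0 (- 1)]) t (3 * (y div a) + 6) ?Q"
    if t: "t (- 6) = w (min a K)" "t (- 4) = int a" "\<And>c. c \<notin> {-4, -5, -6} \<Longrightarrow> t c = s c" for t
  proof -
    define t' where "t' = t(- 10 := s (- 10) + w (min a K), - 7 := int y - int a + 1)"
    have "exec (block [division_loop (- 7) (- 8) (- 4), Sub 0 0 (- 1)]) t' (3 * (y div a) + 3) ?Q"
    proof (rule exec_block_Cons[OF exec_division_loop[where y = y and d = a]])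
      fix u assume u: "u (- 8) = t' (- 8) + int (y div a) \<and> (\<forall>c. c \<noteq> - 7 \<longrightarrow> c \<noteq> - 8 \<longrightarrow> u c = t' c)"
      have "u (- 8) = s (- 8) + int (y div a)" "u (- 10) = s (- 10) + w (min a K)"
        "u 0 = s 0" "u (- 1) = 1" "\<And>c. c > 0 \<or> c \<in> {-3..-1} \<or> c = - 9 \<Longrightarrow> u c = s c"
        using u t(3) assms(1) by (auto simp: t'_def)
      then have "?Q (u(0 := u 0 - u (- 1)))" by auto
      then show "exec (block [Sub 0 0 (- 1)]) u (3 * (y div a) + 3 - (3 * (y div a) + 1)) ?Q"
        by (intro exec_block_basic(3)) (simp_all only: block.simps, auto intro!: exec_basic(1))
    qed (use assms(1,4) t in \<open>auto simp: t'_def\<close>)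
    moreover have "t' = t(- 10 := t (- 10) + t (- 6), - 7 := t (- 3) - t (- 4) + t (- 1))"
      using t assms(1,2) by (auto simp: t'_def)
    ultimately show ?thesis
      by (intro exec_block_basic) (simp_all add: add.commute del: block.simps)
  qed
  define s1 where "s1 = s(- 4 := int a, - 5 := int a)"
  have "exec (block [dispatch K w, Add (- 10) (- 10) (- 6), Sub (- 7) (- 3) (- 4), Add (- 7) (- 7) (- 1),
      division_loop (- 7) (- 8) (- 4), Sub 0 0 (- 1)]) s1 (2 * K + 3 * (y div a) + 7) ?Q"
  proof (rule exec_block_Cons[OF exec_dispatch[where v = a]])
    fix t assume t: "t (- 6) = w (min a K) \<and> (\<forall>c. c \<noteq> - 5 \<longrightarrow> c \<noteq> - 6 \<longrightarrow> t c = s1 c)"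
    have eq: "2 * K + 3 * (y div a) + 7 - (2 * K + 1) = 3 * (y div a) + 6" by simp
    show "exec (block [Add (- 10) (- 10) (- 6), Sub (- 7) (- 3) (- 4), Add (- 7) (- 7) (- 1),
      division_loop (- 7) (- 8) (- 4), Sub 0 0 (- 1)]) t (2 * K + 3 * (y div a) + 7 - (2 * K + 1)) ?Q"
      unfolding eq by (rule 2) (use t in \<open>auto simp: s1_def\<close>)
  qed (use assms in \<open>auto simp: s1_def\<close>)
  moreover have "s1 = s(- 4 := s (s 0), - 5 := (s(- 4 := s (s 0))) ((s(- 4 := s (s 0))) 0))"
    using assms(3,5) by (auto simp: s1_def)
  ultimately have "exec (loop_body K w) s (2 * K + 3 * (y div a) + 9) ?Q"
    unfolding loop_body_def by (intro exec_block_basic) (simp_all add: add.commute del: block.simps)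
  then show ?thesis by (rule exec_mono) (use n in simp_all)
qed

section \<open>The code of an instance and the program computing it\<close>

definition scaled_quotients :: "nat \<Rightarrow> nat list \<Rightarrow> nat" where
  "scaled_quotients N A = (\<Sum>i<length A. N * (length A + 1) div A ! i)"

text \<open>An integer estimate of \<open>N\<close> times the density. The dividends carry the
  factor \<open>length A + 1\<close> so that the rounding errors of all tasks together stay below
  one unit of this estimate.\<close>

definition density_class :: "nat \<Rightarrow> nat list \<Rightarrow> nat" where
  "density_class N A = scaled_quotients N A div (length A + 1)"

text \<open>The code has the density class as its digit \<open>0\<close> in base \<open>N + 1\<close>, and the multiplicity of the
  period \<open>v\<close> as its digit \<open>v\<close>; no digit overflows if the density class is at most \<open>N\<close>.\<close>
definition weight :: "nat \<Rightarrow> nat \<Rightarrow> nat \<Rightarrow> nat" where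
  "weight N K a = (if 1 \<le> a \<and> a \<le> K then (N + 1) ^ a else 0)"

definition code :: "nat \<Rightarrow> nat \<Rightarrow> nat list \<Rightarrow> nat" where
  "code N K A = density_class N A + (\<Sum>i<length A. weight N K (A ! i))"

text \<open>
  Cell \<open>0\<close> counts down the tasks and receives the output. The negative cells hold: \<open>-1\<close> the constant
  \<open>1\<close>; \<open>-2\<close> the divisor \<open>m + 1\<close>; \<open>-3\<close> the dividend \<open>N (m + 1)\<close>; \<open>-4\<close> the current period; \<open>-5\<close> and \<open>-6\<close>
  argument and result of \<open>dispatch\<close>; \<open>-7\<close> a remainder; \<open>-8\<close> the sum of the quotients; \<open>-9\<close> the
  density class; \<open>-10\<close> the sum of the weights.
\<close>
definition pinwheel_program :: "nat \<Rightarrow> nat \<Rightarrow> nat \<Rightarrow> (nat \<Rightarrow> int) \<Rightarrow> program" where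
  "pinwheel_program N K B F = block [Set_Const (- 1) 1, Add (- 2) 0 (- 1),
     block (replicate N (Add (- 3) (- 3) (- 2))),
     While_Pos 0 (loop_body (K + 1) (\<lambda>a. int (weight N K a))),
     Sub (- 8) (- 8) (- 2), Add (- 8) (- 8) (- 1), division_loop (- 8) (- 9) (- 2),
     Set_Const (- 4) (int N), Sub (- 4) (- 9) (- 4),
     If_Pos (- 4) Skip (block [Add (- 5) (- 9) (- 10), dispatch B F, Add 0 0 (- 6)])]"

lemma exec_main_loop:
  fixes A :: "nat list" and N K :: nat
  defines "m \<equiv> length A" and "y \<equiv> N * (length A + 1)"
  assumes A: "\<forall>a\<in>set A. a > 0"
    and s: "s 0 = int m" "s (- 1) = 1" "s (- 2) = int m + 1" "s (- 3) = int y"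
      "s (- 8) = 0" "s (- 9) = 0" "s (- 10) = 0" "\<And>i. i < m \<Longrightarrow> s (int i + 1) = int (A ! i)"
    and n: "m * (2 * K + 3 * y + 13) + 1 \<le> n"
  shows "exec (While_Pos 0 (loop_body (K + 1) (\<lambda>a. int (weight N K a)))) s n
    (\<lambda>s'. s' 0 = 0 \<and> s' (- 1) = 1 \<and> s' (- 2) = int m + 1 \<and> s' (- 8) = int (scaled_quotients N A) \<and>
      s' (- 9) = 0 \<and> s' (- 10) = int (\<Sum>i<m. weight N K (A ! i)))"
proof -
  define I where "I j s' \<longleftrightarrow> s' 0 = int (m - j) \<and> s' (- 1) = 1 \<and> s' (- 2) = int m + 1 \<and>
      s' (- 3) = int y \<and> s' (- 8) = int (\<Sum>i\<in>{m - j..<m}. y div A ! i) \<and> s' (- 9) = 0 \<and>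
      s' (- 10) = int (\<Sum>i\<in>{m - j..<m}. weight N K (A ! i)) \<and>
      (\<forall>i<m. s' (int i + 1) = int (A ! i))" for j and s' :: memory
  have "exec (While_Pos 0 (loop_body (K + 1) (\<lambda>a. int (weight N K a)))) s n (I m)"
  proof (rule exec_While[where c = "2 * (K + 1) + 3 * y + 10"])
    fix j s' assume j: "j < m" and I: "I j s'"
    define i where "i = m - Suc j"
    have i: "i < m" "m - j = Suc i" using j by (auto simp: i_def)
    have s0: "s' 0 = int i + 1" using I i(2) by (simp add: I_def)
    have "exec (loop_body (K + 1) (\<lambda>a. int (weight N K a))) s' (2 * (K + 1) + 3 * y + 10)
       (\<lambda>t. t 0 = s' 0 - 1 \<and> t (- 8) = s' (- 8) + int (y div A ! i) \<and>
         t (- 10) = s' (- 10) + int (weight N K (min (A ! i) (K + 1))) \<and>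
         (\<forall>c. c > 0 \<or> c \<in> {-3..-1} \<or> c = - 9 \<longrightarrow> t c = s' c))"
      using I i(1) A by (intro exec_loop_body) (auto simp: I_def s0 m_def)
    then have "exec (loop_body (K + 1) (\<lambda>a. int (weight N K a))) s' (2 * (K + 1) + 3 * y + 10) (I (Suc j))"
    proof (rule exec_mono)
      fix t assume t: "t 0 = s' 0 - 1 \<and> t (- 8) = s' (- 8) + int (y div A ! i) \<and>
         t (- 10) = s' (- 10) + int (weight N K (min (A ! i) (K + 1))) \<and>
         (\<forall>c. c > 0 \<or> c \<in> {-3..-1} \<or> c = - 9 \<longrightarrow> t c = s' c)"
      have sum: "sum f {i..<m} = f i + sum f {Suc i..<m}" for f :: "nat \<Rightarrow> nat"
        using i(1) by (rule sum.atLeast_Suc_lessThan)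
      \<comment> \<open>The table entry \<open>K + 1\<close> stands for all periods beyond
        \<open>K\<close>; its weight is \<open>0\<close>, as theirs is.\<close>
      have "weight N K (min (A ! i) (K + 1)) = weight N K (A ! i)" by (auto simp: weight_def)
      then show "I (Suc j) t"
        using t I s0 unfolding I_def i(2) i_def[symmetric] sum by auto
    qed simp
    then show "s' 0 > 0 \<and> exec (loop_body (K + 1) (\<lambda>a. int (weight N K a))) s' (2 * (K + 1) + 3 * y + 10) (I (Suc j))"
      using s0 by simp
  next
    show "I 0 s" using s by (simp add: I_def)
    show "m * (2 * (K + 1) + 3 * y + 10 + 1) + 1 \<le> n" using n by (simp add: algebra_simps)
  qed (simp add: I_def)
  then show ?thesis
    by (rule exec_mono) (auto simp: I_def scaled_quotients_def y_def m_def atLeast0LessThan)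
qed

lemma exec_pinwheel_program:
  fixes A :: "nat list"
  defines "m \<equiv> length A"
  assumes A: "\<forall>a\<in>set A. a > 0"
  shows "exec (pinwheel_program N K B F) (input_memory A)
    ((2 * K + 7 * N + 2 * B + 50) * ((m + 1) * (m + 1)))
    (\<lambda>s. s 0 = (if density_class N A > N then 0 else F (min (code N K A) B)))"
    (is "exec _ _ _ ?Q")
proof -
  define y where "y = N * (m + 1)"
  define q where "q = scaled_quotients N A"
  define T where "T = density_class N A"
  define W where "W = (\<Sum>i<m. weight N K (A ! i))"
  \<comment> \<open>The final division takes one round per unit of its quotient, so its time calls
    for a bound on \<open>T\<close> that does not involve the periods.\<close>
  have T_le: "T \<le> m * N"
  proof -
    have "q \<le> (\<Sum>i<m. N * (m + 1))" unfolding q_def scaled_quotients_def m_def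
      by (intro sum_mono) simp
    then have "q \<le> (m * N) * (m + 1)" by (simp add: algebra_simps)
    then have "q div (m + 1) \<le> (m * N) * (m + 1) div (m + 1)" by (rule div_le_mono)
    also have "\<dots> = m * N" by (rule nonzero_mult_div_cancel_right) simp
    finally show ?thesis by (simp only: T_def density_class_def q_def m_def)
  qed
  \<comment> \<open>\<open>C\<close> is the budget of the main loop. The others accumulate from the
    end: \<open>n4\<close> covers the final lookup, \<open>n3\<close> also the division,
    \<open>n2\<close> also the main loop, and \<open>n1\<close> also the computation of
    \<open>N * (m + 1)\<close>.\<close>
  define C where "C = m * (2 * K + 3 * y + 13) + 1"
  define n4 where "n4 = 2 * B + 8"
  define n3 where "n3 = 3 * T + 1 + 2 + n4"
  define n2 where "n2 = C + 2 + n3"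
  define n1 where "n1 = N + 1 + n2"
  have final: "exec (block [If_Pos (- 4) Skip (block [Add (- 5) (- 9) (- 10), dispatch B F, Add 0 0 (- 6)])]) t n4 ?Q"
    if t: "t 0 = 0" "t (- 1) = 1" "t (- 4) = int T - int N" "t (- 9) = int T" "t (- 10) = int W" for t
  proof (rule exec_block_Cons[where ?n1.0 = "2 * B + 6"])
    show "exec (If_Pos (- 4) Skip (block [Add (- 5) (- 9) (- 10), dispatch B F, Add 0 0 (- 6)])) t (2 * B + 6) ?Q"
    proof (rule exec_If)
      \<comment> \<open>The main loop leaves \<open>0\<close> in cell \<open>0\<close>, so skipping
        answers \<open>Unschedulable\<close>.\<close>
      assume "t (- 4) > 0"
      then show "exec Skip t (2 * B + 6 - 1) ?Q" using t by (intro exec_basic) (auto simp: T_def)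
    next
      assume neg: "\<not> t (- 4) > 0"
      define u where "u = t(- 5 := int (T + W))"
      have "exec (block [dispatch B F, Add 0 0 (- 6)]) u (2 * B + 4) ?Q"
      proof (rule exec_block_Cons[OF exec_dispatch[where v = "T + W"]])
        fix v assume v: "v (- 6) = F (min (T + W) B) \<and> (\<forall>c. c \<noteq> - 5 \<longrightarrow> c \<noteq> - 6 \<longrightarrow> v c = u c)"
        have "?Q (v(0 := v 0 + v (- 6)))"
          using v t neg by (simp add: u_def T_def W_def code_def m_def)
        then show "exec (block [Add 0 0 (- 6)]) v (2 * B + 4 - (2 * B + 1)) ?Q"
          by (intro exec_block_basic(2)) (simp_all only: block.simps, auto intro!: exec_basic(1))
      qed (use t in \<open>auto simp: u_def\<close>)
      moreover have "u = t(- 5 := t (- 9) + t (- 10))" using t by (simp add: u_def)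
      ultimately show "exec (block [Add (- 5) (- 9) (- 10), dispatch B F, Add 0 0 (- 6)]) t (2 * B + 6 - 1) ?Q"
        by (intro exec_block_basic) (simp_all add: add.commute del: block.simps)
    qed simp
  qed (auto simp: n4_def intro!: exec_basic)
  have division: "exec (block [division_loop (- 8) (- 9) (- 2), Set_Const (- 4) (int N), Sub (- 4) (- 9) (- 4),
      If_Pos (- 4) Skip (block [Add (- 5) (- 9) (- 10), dispatch B F, Add 0 0 (- 6)])]) t n3 ?Q"
    if t: "t 0 = 0" "t (- 1) = 1" "t (- 2) = int m + 1" "t (- 8) = int q - int m" "t (- 9) = 0" "t (- 10) = int W" for t
  proof (rule exec_block_Cons[OF exec_division_loop[where y = q and d = "m + 1" and n = "3 * T + 1"]])
    have Tq: "q div (m + 1) = T" by (simp add: T_def density_class_def q_def m_def)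
    then show "3 * (q div (m + 1)) + 1 \<le> 3 * T + 1" by simp
    fix u assume u: "u (- 9) = t (- 9) + int (q div (m + 1)) \<and> (\<forall>c. c \<noteq> - 8 \<longrightarrow> c \<noteq> - 9 \<longrightarrow> u c = t c)"
    have "exec (block [If_Pos (- 4) Skip (block [Add (- 5) (- 9) (- 10), dispatch B F, Add 0 0 (- 6)])])
        (u(- 4 := u (- 9) - int N)) n4 ?Q"
      using u t Tq by (intro final) auto
    moreover have "n3 - (3 * T + 1) - 1 - 1 = n4" by (simp add: n3_def)
    ultimately show "exec (block [Set_Const (- 4) (int N), Sub (- 4) (- 9) (- 4),
       If_Pos (- 4) Skip (block [Add (- 5) (- 9) (- 10), dispatch B F, Add 0 0 (- 6)])]) u (n3 - (3 * T + 1)) ?Q"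
      by (intro exec_block_basic) (simp_all del: block.simps add: n3_def)
  qed (use t in \<open>auto simp: n3_def\<close>)
  have loop: "exec (block [While_Pos 0 (loop_body (K + 1) (\<lambda>a. int (weight N K a))),
     Sub (- 8) (- 8) (- 2), Add (- 8) (- 8) (- 1), division_loop (- 8) (- 9) (- 2),
     Set_Const (- 4) (int N), Sub (- 4) (- 9) (- 4),
     If_Pos (- 4) Skip (block [Add (- 5) (- 9) (- 10), dispatch B F, Add 0 0 (- 6)])]) t n2 ?Q"
    if t: "t = (input_memory A)(- 1 := 1, - 2 := int m + 1, - 3 := int y)" for t
  proof (rule exec_block_Cons[OF exec_main_loop[OF A, where N = N and K = K and n = C]])
    fix u :: memory
    assume u: "u 0 = 0 \<and> u (- 1) = 1 \<and> u (- 2) = int (length A) + 1 \<and> u (- 8) = int (scaled_quotients N A) \<and>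
      u (- 9) = 0 \<and> u (- 10) = int (\<Sum>i<length A. weight N K (A ! i))"
    have "exec (block [division_loop (- 8) (- 9) (- 2), Set_Const (- 4) (int N), Sub (- 4) (- 9) (- 4),
      If_Pos (- 4) Skip (block [Add (- 5) (- 9) (- 10), dispatch B F, Add 0 0 (- 6)])])
      (u(- 8 := u (- 8) - u (- 2) + u (- 1))) n3 ?Q"
      using u by (intro division) (auto simp: m_def q_def W_def)
    moreover have "n2 - C - 1 - 1 = n3" by (simp add: n2_def)
    ultimately show "exec (block [Sub (- 8) (- 8) (- 2), Add (- 8) (- 8) (- 1), division_loop (- 8) (- 9) (- 2),
     Set_Const (- 4) (int N), Sub (- 4) (- 9) (- 4),
     If_Pos (- 4) Skip (block [Add (- 5) (- 9) (- 10), dispatch B F, Add 0 0 (- 6)])]) u (n2 - C) ?Q"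
      by (intro exec_block_basic) (simp_all del: block.simps add: n2_def)
  qed (auto simp: t input_memory_def m_def y_def C_def n2_def nat_add_distrib)
  define s1 where "s1 = (input_memory A)(- 1 := 1, - 2 := int m + 1)"
  have "exec (block [block (replicate N (Add (- 3) (- 3) (- 2))),
     While_Pos 0 (loop_body (K + 1) (\<lambda>a. int (weight N K a))),
     Sub (- 8) (- 8) (- 2), Add (- 8) (- 8) (- 1), division_loop (- 8) (- 9) (- 2),
     Set_Const (- 4) (int N), Sub (- 4) (- 9) (- 4),
     If_Pos (- 4) Skip (block [Add (- 5) (- 9) (- 10), dispatch B F, Add 0 0 (- 6)])]) s1 n1 ?Q"
  proof (rule exec_block_Cons[OF exec_replicate_Add[where n = "N + 1"]])
    fix t assume "t = s1(- 3 := s1 (- 3) + int N * s1 (- 2))"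
    then have t: "t = (input_memory A)(- 1 := 1, - 2 := int m + 1, - 3 := int y)"
      by (simp add: s1_def y_def input_memory_def algebra_simps)
    have n: "n1 - (N + 1) = n2" by (simp add: n1_def)
    show "exec (block [While_Pos 0 (loop_body (K + 1) (\<lambda>a. int (weight N K a))),
     Sub (- 8) (- 8) (- 2), Add (- 8) (- 8) (- 1), division_loop (- 8) (- 9) (- 2),
     Set_Const (- 4) (int N), Sub (- 4) (- 9) (- 4),
     If_Pos (- 4) Skip (block [Add (- 5) (- 9) (- 10), dispatch B F, Add 0 0 (- 6)])]) t (n1 - (N + 1)) ?Q"
      unfolding n by (rule loop[OF t])
  qed (simp_all add: n1_def)
  moreover have "s1 = (input_memory A)(- 1 := 1, - 2 := ((input_memory A)(- 1 := 1)) 0 + ((input_memory A)(- 1 := 1)) (- 1))"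
    by (simp add: s1_def input_memory_def m_def)
  ultimately have "exec (pinwheel_program N K B F) (input_memory A) (n1 + 2) ?Q"
    unfolding pinwheel_program_def by (intro exec_block_basic) (simp_all del: block.simps)
  moreover have "n1 + 2 \<le> (2 * K + 7 * N + 2 * B + 50) * ((m + 1) * (m + 1))"
  proof -
    define X where "X = (m + 1) * (m + 1)"
    have X: "1 \<le> X" "m \<le> X" "m * (m + 1) \<le> X" by (simp_all add: X_def)
    have "n1 + 2 = N + 1 + (m * (2 * K + 13) + 3 * N * (m * (m + 1)) + 1) + 2 + (3 * T + 1 + 2 + (2 * B + 8)) + 2"
      by (simp add: n1_def n2_def n3_def n4_def C_def y_def algebra_simps)
    also have "\<dots> \<le> N + 1 + (m * (2 * K + 13) + 3 * N * (m * (m + 1)) + 1) + 2 + (3 * (m * N) + 1 + 2 + (2 * B + 8)) + 2"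
      using T_le by simp
    also have "\<dots> = m * (2 * K + 13) + 3 * N * (m * (m + 1)) + m * (3 * N) + 1 * (N + 2 * B + 17)"
      by simp
    also have "\<dots> \<le> X * (2 * K + 13) + 3 * N * X + X * (3 * N) + X * (N + 2 * B + 17)"
      using X by (intro add_mono mult_le_mono) auto
    also have "\<dots> \<le> (2 * K + 7 * N + 2 * B + 50) * X" by (simp add: algebra_simps)
    finally show ?thesis by (simp add: X_def)
  qed
  ultimately show ?thesis by (rule exec_mono) simp
qed

section \<open>Recovering density and multiplicities from the code\<close>

lemma density_class_bounds:
  assumes A: "\<forall>a\<in>set A. a > 0" and N: "N > 0"
  shows "real (density_class N A) \<le> real N * density A UNIV"
    and "real N * density A UNIV < real (density_class N A) + 2"
proof -
  let ?n = "length A + 1"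
  have D: "real N * density A UNIV * real ?n = (\<Sum>i<length A. real (N * ?n) / real (A ! i))"
    by (simp add: density_def sum_distrib_left lessThan_def mult_ac add_ac distrib_left)
  have le: "real (b div a) \<le> real b / real a" for a b
    using real_of_int_div4[of "int b" "int a"] by (simp flip: of_nat_div)
  have ge: "real b / real a \<le> real (b div a) + 1" for a b
    using real_of_int_div3[of "int b" "int a"] by (simp flip: of_nat_div)
  define q where "q = scaled_quotients N A"
  have "real q \<le> real N * density A UNIV * real ?n"
    unfolding D q_def scaled_quotients_def of_nat_sum by (intro sum_mono le)
  \<comment> \<open>Rounding down loses at most \<open>1\<close> per task, so less than
    \<open>1\<close> in total after division by \<open>length A + 1\<close>; that integer division
    loses less than \<open>1\<close> more.\<close>
  have hi: "real N * density A UNIV * real ?n \<le> real q + real (length A)"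
  proof -
    have "(\<Sum>i<length A. real (N * ?n) / real (A ! i)) \<le> (\<Sum>i<length A. real (N * ?n div A ! i) + 1)"
      by (intro sum_mono ge)
    then show ?thesis unfolding D q_def scaled_quotients_def by (simp add: sum.distrib)
  qed
  have T: "density_class N A * ?n \<le> q" "q < density_class N A * ?n + ?n"
    unfolding density_class_def q_def[symmetric]
    by (rule div_times_less_eq_dividend) (metis add.commute add_gr_0 dividend_less_div_times less_numeral_extra(1))
  have "real (density_class N A) * real ?n \<le> real q" using T(1) by (metis of_nat_le_iff of_nat_mult)
  also have "\<dots> \<le> real N * density A UNIV * real ?n" by fact
  finally show "real (density_class N A) \<le> real N * density A UNIV"
    by (rule mult_right_le_imp_le) simp
  have "real q < real (density_class N A * ?n + ?n)" using T(2) by (simp only: of_nat_less_iff)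
  then have "real N * density A UNIV * real ?n < (real (density_class N A) + 2) * real ?n"
    using hi by (simp add: algebra_simps)
  then show "real N * density A UNIV < real (density_class N A) + 2"
    by (rule mult_right_less_imp_less) simp
qed

text \<open>The lowest digit is the remainder modulo \<open>B\<close>; the others follow by
  induction on the number of digits.\<close>

lemma digits_unique:
  fixes d e :: "nat \<Rightarrow> nat"
  assumes "\<And>v. v \<le> K \<Longrightarrow> d v < B" "\<And>v. v \<le> K \<Longrightarrow> e v < B"
    and "(\<Sum>v\<le>K. d v * B ^ v) = (\<Sum>v\<le>K. e v * B ^ v)" "v \<le> K"
  shows "d v = e v"
  using assms
proof (induction K arbitrary: d e v)
  case 0
  then show ?case by simp
next
  case (Suc K)
  have split: "(\<Sum>v\<le>Suc K. f v * B ^ v) = f 0 + B * (\<Sum>v\<le>K. f (Suc v) * B ^ v)" for f :: "nat \<Rightarrow> nat"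
    unfolding sum.atMost_Suc_shift by (simp add: sum_distrib_left mult_ac)
  have eq: "d 0 + B * (\<Sum>v\<le>K. d (Suc v) * B ^ v) = e 0 + B * (\<Sum>v\<le>K. e (Suc v) * B ^ v)"
    using Suc.prems(3) by (simp only: split)
  have lt: "d 0 < B" "e 0 < B" using Suc.prems(1,2) by auto
  then have "B > 0" by simp
  have "d 0 = (d 0 + B * (\<Sum>v\<le>K. d (Suc v) * B ^ v)) mod B" using lt by simp
  also have "\<dots> = e 0" unfolding eq using lt by simp
  finally have 0: "d 0 = e 0" .
  then have "(\<Sum>v\<le>K. d (Suc v) * B ^ v) = (\<Sum>v\<le>K. e (Suc v) * B ^ v)"
    using eq \<open>B > 0\<close> by simp
  then have "d (Suc w) = e (Suc w)" if "w \<le> K" for w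
    using Suc.IH[of "\<lambda>v. d (Suc v)" "\<lambda>v. e (Suc v)" w] Suc.prems(1,2) that by simp
  then show ?case using 0 Suc.prems(4) by (cases v) auto
qed

lemma multiplicity_of_0:
  assumes "\<forall>a\<in>set A. a > 0"
  shows "multiplicity_of A 0 = 0"
proof -
  have "{i. i < length A \<and> A ! i = 0} = {}" using assms nth_mem by fastforce
  then show ?thesis by (simp only: multiplicity_of_def card.empty)
qed

text \<open>Since \<open>v \<le> N\<close>, each task of period \<open>v\<close> contributes at
  least \<open>length A + 1\<close> to \<open>scaled_quotients\<close>, hence at least one unit to
  the density class.\<close>

lemma multiplicity_le:
  assumes A: "\<forall>a\<in>set A. a > 0" and N: "K \<le> N" "v \<le> K" and T: "density_class N A \<le> N"
  shows "multiplicity_of A v \<le> N"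
proof (cases "v = 0")
  case True
  then show ?thesis using multiplicity_of_0[OF A] by simp
next
  case v: False
  let ?n = "length A + 1"
  have "v * ?n \<le> N * ?n" using N by (intro mult_le_mono1) simp
  then have "v * ?n div v \<le> N * ?n div v" by (rule div_le_mono)
  then have "?n \<le> N * ?n div v" using v by simp
  then have "multiplicity_of A v * ?n \<le> multiplicity_of A v * (N * ?n div v)" by (rule mult_le_mono2)
  also have "\<dots> = (\<Sum>i\<in>{i. i < length A \<and> A ! i = v}. N * ?n div A ! i)"
    by (simp add: multiplicity_of_def)
  also have "\<dots> \<le> scaled_quotients N A"
    unfolding scaled_quotients_def by (intro sum_mono2) auto
  also have "\<dots> < density_class N A * ?n + ?n"
    unfolding density_class_def by (metis add.commute add_gr_0 dividend_less_div_times less_numeral_extra(1))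
  also have "\<dots> \<le> (N + 1) * ?n" using T by (simp add: add_mono mult_le_mono)
  finally have "multiplicity_of A v < N + 1" by (simp only: mult_less_cancel2)
  then show ?thesis by simp
qed

lemma code_eq_digits:
  assumes A: "\<forall>a\<in>set A. a > 0"
  shows "code N K A = (\<Sum>v\<le>K. (if v = 0 then density_class N A else multiplicity_of A v) * (N + 1) ^ v)"
proof -
  have "(\<Sum>i<length A. weight N K (A ! i)) = (\<Sum>i\<in>{i. i < length A \<and> A ! i \<in> {1..K}}. (N + 1) ^ (A ! i))"
    by (rule sum.mono_neutral_cong_right) (auto simp: weight_def)
  also have "\<dots> = (\<Sum>v\<in>{1..K}. \<Sum>i\<in>{i \<in> {i. i < length A \<and> A ! i \<in> {1..K}}. A ! i = v}. (N + 1) ^ (A ! i))"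
    by (rule sum.group[symmetric]) auto
  also have "\<dots> = (\<Sum>v\<in>{1..K}. multiplicity_of A v * (N + 1) ^ v)"
  proof (rule sum.cong)
    fix v assume "v \<in> {1..K}"
    then have "{i \<in> {i. i < length A \<and> A ! i \<in> {1..K}}. A ! i = v} = {i. i < length A \<and> A ! i = v}" by auto
    then show "(\<Sum>i\<in>{i \<in> {i. i < length A \<and> A ! i \<in> {1..K}}. A ! i = v}. (N + 1) ^ (A ! i)) =
        multiplicity_of A v * (N + 1) ^ v"
      by (simp add: multiplicity_of_def)
  qed simp
  also have "density_class N A + \<dots> = (\<Sum>v\<le>K. (if v = 0 then density_class N A else multiplicity_of A v) * (N + 1) ^ v)"
  proof -
    have "{..K} = insert 0 {1..K}" by auto
    then show ?thesis by simp
  qed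
  finally show ?thesis by (simp add: code_def)
qed

text \<open>All digits are at most \<open>N\<close>, so a table whose size depends neither on the
  number of tasks nor on the periods covers every code that is looked up.\<close>

lemma code_less:
  assumes A: "\<forall>a\<in>set A. a > 0" and N: "K \<le> N" and T: "density_class N A \<le> N"
  shows "code N K A < (K + 1) * (N * (N + 1) ^ K) + 1"
proof -
  have "code N K A \<le> (\<Sum>v\<le>K. N * (N + 1) ^ K)"
    unfolding code_eq_digits[OF A]
  proof (intro sum_mono mult_le_mono)
    fix v assume "v \<in> {..K}"
    then show "(if v = 0 then density_class N A else multiplicity_of A v) \<le> N"
      using T multiplicity_le[OF A N _ T] by simp
    show "(N + 1) ^ v \<le> (N + 1) ^ K" using \<open>v \<in> {..K}\<close> by (intro power_increasing) auto
  qed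
  then show ?thesis by simp
qed

lemma code_determines:
  assumes "\<forall>a\<in>set A. a > 0" "\<forall>a\<in>set A'. a > 0" "K \<le> N"
    and "density_class N A \<le> N" "density_class N A' \<le> N" "code N K A = code N K A'"
  shows "density_class N A = density_class N A'"
    and "v \<le> K \<Longrightarrow> multiplicity_of A v = multiplicity_of A' v"
proof -
  let ?d = "\<lambda>A v. if v = 0 then density_class N A else multiplicity_of A v"
  have lt: "?d A v < N + 1" if "\<forall>a\<in>set A. a > 0" "density_class N A \<le> N" "v \<le> K" for A v
    using that multiplicity_le[OF that(1) assms(3) that(3,2)] by simp
  have eq: "?d A v = ?d A' v" if "v \<le> K" for v
  proof (rule digits_unique[where d = "?d A" and e = "?d A'" and B = "N + 1" and K = K])
    show "(\<Sum>v\<le>K. ?d A v * (N + 1) ^ v) = (\<Sum>v\<le>K. ?d A' v * (N + 1) ^ v)"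
      using assms(6) unfolding code_eq_digits[OF assms(1)] code_eq_digits[OF assms(2)] .
    show "?d A v < N + 1" if "v \<le> K" for v using assms(1,4) that by (rule lt)
    show "?d A' v < N + 1" if "v \<le> K" for v using assms(2,5) that by (rule lt)
  qed fact
  show "density_class N A = density_class N A'" using eq[of 0] by simp
  show "multiplicity_of A v = multiplicity_of A' v" if "v \<le> K"
  proof (cases "v = 0")
    case True
    then show ?thesis using multiplicity_of_0 assms(1,2) by simp
  qed (use eq[OF that] in simp)
qed

section \<open>The approximation scheme\<close>

theorem theorem1:
  "\<exists>d::nat. \<forall>\<epsilon>::real. \<epsilon> > 0 \<longrightarrow>
     (\<exists>(P::program) (p::nat poly). degree p \<le> d \<and>
        solves_approx_pinwheel_in_time P (1 + \<epsilon>) (poly p))"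
proof (intro exI[of _ 2] allI impI)
  fix \<epsilon> :: real assume \<epsilon>: "\<epsilon> > 0"
  obtain k' :: nat where k': "inverse (real (Suc k')) < \<epsilon>" using reals_Archimedean[OF \<epsilon>] by blast
  define k where "k = Suc k'"
  have k: "k \<ge> 1" "1 / real k \<le> \<epsilon>" using k' by (simp_all add: k_def inverse_eq_divide)
  define K where "K = threshold k (12 * (k + 1))"
  \<comment> \<open>\<open>K \<le> N\<close> keeps the digits of the code from overflowing, and
    \<open>16 * k \<le> N\<close> bounds the density error \<open>2 / N\<close> by the tolerance
    \<open>1 / (8 * k)\<close>.\<close>
  define N where "N = max K (16 * k)"
  have N: "K \<le> N" "N > 0" "16 * k \<le> N" using k by (auto simp: N_def)
  define B where "B = (K + 1) * (N * (N + 1) ^ K) + 1"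
  \<comment> \<open>A nonconstructive table: its entry at \<open>z\<close> tells whether some
    schedulable instance has the code \<open>z\<close>. Only the entries up to \<open>B\<close>
    enter the program, as constants fixed together with \<open>\<epsilon>\<close>.\<close>
  define F :: "nat \<Rightarrow> int" where "F z = (if \<exists>A. (\<forall>a\<in>set A. a > 0) \<and> schedulable (map real A) \<and>
     density_class N A \<le> N \<and> code N K A = z then 1 else 0)" for z
  define C where "C = 2 * K + 7 * N + 2 * B + 50"
  define p :: "nat poly" where "p = [:C, 2 * C, C:]"
  \<comment> \<open>Density at most \<open>1\<close> survives rounding down, so a class above
    \<open>N\<close> proves unschedulability.\<close>
  have class_le: "density_class N A \<le> N" if "\<forall>a\<in>set A. a > 0" "schedulable (map real A)" for A
  proof -
    have "real (density_class N A) \<le> real N * density A UNIV"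
      using that(1) N(2) by (rule density_class_bounds)
    also have "\<dots> \<le> real N * 1" using schedulable_density_le_1[OF that(2)] by (intro mult_left_mono) auto
    finally show ?thesis by simp
  qed
  have "solves_approx_pinwheel_in_time (pinwheel_program N K B F) (1 + \<epsilon>) (poly p)"
    unfolding solves_approx_pinwheel_in_time_def
  proof (intro allI impI)
    fix A' :: "nat list" assume A': "\<forall>a\<in>set A'. a > 0"
    have "poly p (length A') = C * ((length A' + 1) * (length A' + 1))"
      by (simp add: p_def algebra_simps)
    then obtain t s where run: "run (pinwheel_program N K B F) (input_memory A') t s" "t \<le> poly p (length A')"
      and s0: "s 0 = (if density_class N A' > N then 0 else F (min (code N K A') B))"
      using exec_pinwheel_program[OF A', of N K B F] unfolding exec_def C_def by metis
    have "correct_verdict (1 + \<epsilon>) A' (output_verdict s)"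
    proof (cases "density_class N A' \<le> N \<and> F (code N K A') > 0")
      case True
      then have "min (code N K A') B = code N K A'"
        using code_less[OF A' N(1)] by (simp add: B_def)
      then have out: "output_verdict s = Stretched_Schedulable"
        using s0 True by (simp add: output_verdict_def)
      \<comment> \<open>The table certifies only some schedulable instance \<open>A\<close> with the
        code of \<open>A'\<close>; stability carries schedulability over to the stretched
        \<open>A'\<close>.\<close>
      obtain A where A: "\<forall>a\<in>set A. a > 0" "schedulable (map real A)" "density_class N A \<le> N"
        "code N K A = code N K A'"
        using True unfolding F_def by (auto split: if_splits)
      note same = code_determines[OF A(1) A' N(1) A(3) conjunct1[OF True] A(4)]
      have "serves UNIV (\<lambda>i. (1 + 1 / real k) * real (A' ! i)) {..<length A'}"
      proof (rule stretched_schedulable_if_similar[OF k(1) A(2,1) A'])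
        show "multiplicity_of A v = multiplicity_of A' v" if "v \<le> threshold k (12 * (k + 1))" for v
          using same(2) that by (simp add: K_def)
        have "real N * density A' UNIV \<le> real N * density A UNIV + 2"
          using density_class_bounds[OF A(1) N(2)] density_class_bounds[OF A' N(2)] same(1) by linarith
        then have "density A' UNIV \<le> density A UNIV + 2 / real N"
          using N(2) by (simp add: field_simps)
        moreover have "2 / real N \<le> 1 / (8 * real k)"
        proof -
          have "16 * real k \<le> real N" using N(3) by linarith
          then show ?thesis using N(2) k(1) by (simp add: field_simps)
        qed
        ultimately show "density A' UNIV \<le> density A UNIV + 1 / (8 * real k)" by linarith
      qed
      then have "serves UNIV ((!) (map (\<lambda>a. (1 + \<epsilon>) * real a) A')) {..<length A'}"
      proof (rule serves_antimono_period)
        fix i assume i: "i \<in> {..<length A'}"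
        then have "real (A' ! i) > 0" using A' by simp
        moreover have "0 < 1 + 1 / real k" "1 + 1 / real k \<le> 1 + \<epsilon>" using k by (simp_all add: add_pos_nonneg)
        ultimately show "0 < (1 + 1 / real k) * real (A' ! i) \<and>
            (1 + 1 / real k) * real (A' ! i) \<le> map (\<lambda>a. (1 + \<epsilon>) * real a) A' ! i"
          using i by (auto intro!: mult_right_mono mult_pos_pos)
      qed
      then show ?thesis using out by (simp add: schedulable_iff_serves)
    next
      case False
      have "\<not> schedulable (map real A')"
      proof
        assume sched: "schedulable (map real A')"
        have "density_class N A' \<le> N" using class_le[OF A' sched] .
        \<comment> \<open>A schedulable \<open>A'\<close> is its own witness in the table.\<close>
        moreover from this have "F (code N K A') = 1"
          unfolding F_def using sched A' by (intro if_P exI[of _ A']) auto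
        ultimately show False using False by simp
      qed
      moreover have "\<not> s 0 > 0"
      proof (cases "density_class N A' \<le> N")
        case True
        then have "min (code N K A') B = code N K A'"
          using code_less[OF A' N(1)] by (simp add: B_def)
        then show ?thesis using s0 True False by simp
      qed (simp add: s0)
      ultimately show ?thesis by (simp add: output_verdict_def)
    qed
    then show "\<exists>t s. run (pinwheel_program N K B F) (input_memory A') t s \<and> t \<le> poly p (length A') \<and>
        correct_verdict (1 + \<epsilon>) A' (output_verdict s)"
      using run by blast
  qed
  moreover have "degree p \<le> 2" by (simp add: p_def)
  ultimately show "\<exists>(P::program) (p::nat poly). degree p \<le> 2 \<and>
      solves_approx_pinwheel_in_time P (1 + \<epsilon>) (poly p)"
    by blast
qed

end
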